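(* Let $J$ be a nonnegative integer or half-integer, and let $q\in\mathbb{R}^+$ or let $q\in S^1$ be generic (i.e. $q=e^{i\tau}$ different from a root of unity). The function $Q_{Jq}(\eta)$, $\eta=z\bar z$, which enters the basis functions of the su$_q$(2) representations and is defined (up to a multiplicative factor $f_{Jq}(\eta)$ such that $f_{Jq}(q^2\eta)=f_{Jq}(\eta)$) by the functional equation $$Q_{Jq}(q^2\eta)\,(1+\eta)=Q_{Jq}(\eta)\,(1+q^{-2J}\eta),$$ is given as follows. (i) For integer $J$ values, and either $q\in\mathbb{R}^+$ or generic $q\in S^1$: $$Q_{Jq}(\eta)=\prod_{k=0}^{J-1}\left(\frac{1}{1+\eta q^{-2J+2k}}\right).$$ (ii) For half-integer (i.e. half-odd-integer) $J$ values, and $q\in\mathbb{R}^+$: $$Q_{Jq}(\eta)=\prod_{k=0}^{\infty}\frac{1+q^{2k}\eta}{1+q^{-2J+2k}\eta}\quad\text{if }0<q<1,\qquad Q_{Jq}(\eta)=\prod_{k=0}^{\infty}\frac{1+q^{-2J-2k-2}\eta}{1+q^{-2k-2}\eta}\quad\text{if }q>1.$$ (iii) For half-integer (i.e. half-odd-integer) $J$ values, and generic $q\in S^1$, it can be expressed as $$Q_{Jq}(\eta)=\exp\left\{L_q\left(q^{-2J-1}\eta\right)-L_q\left(q^{-1}\eta\right)\right\},$$ where $L_q(\eta)$ admits the integral representation given in the context.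
   Context: The basis functions of the su$_q$(2) representations on the sphere (projected onto the plane with complex coordinate $z$) have the form (constant)$\,\times\,Q_{Jq}(\eta)\,R(\eta)\,\bar z^{M+N}$, where $\eta=z\bar z$ and $R$ is a polynomial in $\eta$. For $q=e^{i\tau}$ different from a root of unity, $L_q$ is the solution of the difference equation $$L_q(q\eta)-L_q(q^{-1}\eta)=\ln(1+\eta)$$ which, for $0<\eta<\infty$, is given by the integral representation $$L_q(\eta)=\frac{1}{2\pi i}\int_0^\infty\frac{dt}{t(1+t)}\ln\left(1+\eta t^{\tau/\pi}\right)\quad\text{if }0<\tau<\pi,$$ $$L_q(\eta)=-\frac{1}{2\pi i}\int_0^\infty\frac{dt}{t(1+t)}\ln\left(1+\eta t^{-\tau/\pi}\right)\quad\text{if }-\pi<\tau<0.$$ *)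

theory Defs
  imports "HOL-Analysis.Analysis"
begin

text \<open>Throughout, \<open>q\<close> is a complex number that is either a positive real or a unimodular
  number different from a root of unity. In both cases the principal power \<open>q powr x\<close> is the
  intended one: it is the positive real power for \<open>q > 0\<close> and \<open>e\<^bsup>i\<tau>x\<^esup>\<close> for
  \<open>q = e\<^bsup>i\<tau>\<^esup>\<close>, \<open>\<tau> = Arg q\<close>, \<open>-\<pi> < \<tau> < \<pi>\<close>.\<close>

definition pos_real :: "complex \<Rightarrow> bool" where
  "pos_real q \<longleftrightarrow> q \<in> \<real> \<and> 0 < Re q"

definition generic_unit :: "complex \<Rightarrow> bool" where
  "generic_unit q \<longleftrightarrow> norm q = 1 \<and> (\<forall>n::nat. 0 < n \<longrightarrow> q ^ n \<noteq> 1)"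


section \<open>The functional equation in the complex plane\<close>

text \<open>The values \<open>q\<^sup>2\<eta>\<close> are not real for \<open>\<bar>q\<bar> = 1\<close>, so \<open>\<eta>\<close> has to be complex. We take all
  \<open>\<eta>\<close> for which neither of the coefficients \<open>1 + \<eta>\<close> and \<open>1 + q\<^bsup>-2J\<^esup>\<eta>\<close> vanishes anywhere on the
  orbit \<open>{q\<^bsup>2n\<^esup>\<eta> | n \<in> \<int>}\<close>. This set is invariant under \<open>\<eta> \<mapsto> q\<^sup>2\<eta>\<close> and contains all real
  \<open>\<eta> \<ge> 0\<close>, i.e. all values of \<open>z * cnj z\<close> (both facts are proved below).\<close>

definition eta_dom :: "complex \<Rightarrow> real \<Rightarrow> complex set" where
  "eta_dom q J = {\<eta>. \<forall>n::int. 1 + q powi (2 * n) * \<eta> \<noteq> 0 \<and>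
                        1 + q powr of_real (- 2 * J) * (q powi (2 * n) * \<eta>) \<noteq> 0}"

definition Q_equation :: "complex \<Rightarrow> real \<Rightarrow> (complex \<Rightarrow> complex) \<Rightarrow> bool" where
  "Q_equation q J Q \<longleftrightarrow> (\<forall>\<eta>\<in>eta_dom q J.
     Q (q\<^sup>2 * \<eta>) * (1 + \<eta>) = Q \<eta> * (1 + q powr of_real (- 2 * J) * \<eta>))"

text \<open>\<open>Q0\<close> is the function defined by the functional equation up to a factor \<open>f\<close> with
  \<open>f (q\<^sup>2\<eta>) = f \<eta>\<close>.\<close>

definition Q_given_by :: "complex \<Rightarrow> real \<Rightarrow> (complex \<Rightarrow> complex) \<Rightarrow> bool" where
  "Q_given_by q J Q0 \<longleftrightarrow>
     (\<forall>\<eta>\<in>eta_dom q J. Q0 \<eta> \<noteq> 0) \<and> Q_equation q J Q0 \<and>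
     (\<forall>Q. Q_equation q J Q \<longleftrightarrow>
        (\<exists>f. (\<forall>\<eta>\<in>eta_dom q J. f (q\<^sup>2 * \<eta>) = f \<eta>) \<and> (\<forall>\<eta>\<in>eta_dom q J. Q \<eta> = f \<eta> * Q0 \<eta>)))"

lemma eta_dom_invariant:
  assumes "q \<noteq> 0" "\<eta> \<in> eta_dom q J"
  shows "q\<^sup>2 * \<eta> \<in> eta_dom q J"
proof -
  have *: "q powi (2 * n) * (q\<^sup>2 * \<eta>) = q powi (2 * (n + 1)) * \<eta>" for n :: int
    using assms(1) by (simp add: power_int_add distrib_left)
  show ?thesis
    using assms(2) unfolding eta_dom_def mem_Collect_eq * by blast
qed

lemma nonneg_real_in_eta_dom:
  assumes q: "pos_real q \<or> generic_unit q" and J: "2 * J \<in> \<nat>" and x: "0 \<le> x"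
  shows "complex_of_real x \<in> eta_dom q J"
proof -
  obtain m :: nat where m: "2 * J = real m" using J by (auto elim: Nats_cases)
  have q0: "q \<noteq> 0" using q by (auto simp: pos_real_def generic_unit_def)
  have "(of_real (- 2 * J) :: complex) = of_int (- int m)" using m by simp
  then have pw: "q powr of_real (- 2 * J) = q powi (- int m)"
    using q0 complex_powr_of_int by presburger
  have main: "1 + q powi k * of_real x \<noteq> 0" for k :: int
  proof
    assume eq: "1 + q powi k * of_real x = 0"
    from q show False
    proof
      assume "pos_real q"
      then obtain r where r: "q = of_real r" "0 < r"
        by (auto simp: pos_real_def Reals_def)
      have "complex_of_real (1 + r powi k * x) = 0" using eq r by simp
      then have "1 + r powi k * x = 0" by (simp only: of_real_eq_0_iff)
      moreover have "0 \<le> r powi k * x" using r x by simp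
      ultimately show False by linarith
    next
      assume g: "generic_unit q"
      have e: "q powi k * of_real x = -1" using eq by (simp add: add_eq_0_iff)
      then have "norm (q powi k) * x = 1" using x
        by (metis norm_minus_cancel norm_mult norm_of_real norm_one abs_of_nonneg)
      then have "x = 1" using g by (simp add: norm_power_int generic_unit_def)
      with e have e1: "q powi k = -1" by simp
      have "q ^ nat \<bar>k\<bar> = -1"
      proof (cases "0 \<le> k")
        case True
        then show ?thesis using e1 by (simp add: power_int_def)
      next
        case False
        then have "inverse (q ^ nat \<bar>k\<bar>) = -1"
          using e1 by (simp add: power_int_def power_inverse)
        then have "inverse (inverse (q ^ nat \<bar>k\<bar>)) = inverse (-1)" by (rule arg_cong)
        then show ?thesis by simp
      qed
      then have e2: "q ^ (2 * nat \<bar>k\<bar>) = 1" by (simp add: power_mult mult.commute[of 2])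
      have "k \<noteq> 0" using e1 by auto
      then show False using g e2 by (auto simp: generic_unit_def)
    qed
  qed
  have shift: "q powi (- int m) * (q powi (2 * n) * \<eta>) = q powi (2 * n - int m) * \<eta>" for n \<eta>
    using q0 by (simp add: power_int_diff power_int_minus field_simps)
  show ?thesis unfolding eta_dom_def pw mem_Collect_eq shift using main by blast
qed


section \<open>The functional equation on the Riemann surface of the logarithm\<close>

text \<open>For unimodular \<open>q\<close> the analytic continuation of \<open>L\<^sub>q\<close> from \<open>0 < \<eta> < \<infinity>\<close> is multivalued in
  \<open>\<eta>\<close>. It is a function of \<open>w = ln \<eta>\<close>; the positive half-line corresponds to real \<open>w\<close>, and
  \<open>\<eta> \<mapsto> q\<^bsup>a\<^esup>\<eta>\<close> becomes \<open>w \<mapsto> w + i a \<tau>\<close> with \<open>\<tau> = Arg q\<close>.\<close>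

definition Q_equation_log :: "complex \<Rightarrow> real \<Rightarrow> (complex \<Rightarrow> complex) \<Rightarrow> bool" where
  "Q_equation_log q J Q \<longleftrightarrow> (\<forall>w. exp w \<in> eta_dom q J \<longrightarrow>
     Q (w + 2 * \<i> * of_real (Arg q)) * (1 + exp w)
       = Q w * (1 + q powr of_real (- 2 * J) * exp w))"

definition Q_given_by_log :: "complex \<Rightarrow> real \<Rightarrow> (complex \<Rightarrow> complex) \<Rightarrow> bool" where
  "Q_given_by_log q J Q0 \<longleftrightarrow>
     (\<forall>w. exp w \<in> eta_dom q J \<longrightarrow> Q0 w \<noteq> 0) \<and> Q_equation_log q J Q0 \<and>
     (\<forall>Q. Q_equation_log q J Q \<longleftrightarrow>
        (\<exists>f. (\<forall>w. exp w \<in> eta_dom q J \<longrightarrow> f (w + 2 * \<i> * of_real (Arg q)) = f w) \<and>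
             (\<forall>w. exp w \<in> eta_dom q J \<longrightarrow> Q w = f w * Q0 w)))"


section \<open>The function \<open>L\<^sub>q\<close>\<close>

definition Lq_integrand :: "real \<Rightarrow> real \<Rightarrow> real \<Rightarrow> real" where
  "Lq_integrand \<tau> \<eta> t =
     ln (1 + \<eta> * t powr (if 0 < \<tau> then \<tau> / pi else - \<tau> / pi)) / (t * (1 + t))"

definition Lq_integral :: "real \<Rightarrow> real \<Rightarrow> complex" where
  "Lq_integral \<tau> \<eta> =
     (if 0 < \<tau> then 1 / (2 * pi * \<i>) else - 1 / (2 * pi * \<i>))
       * of_real (integral {0<..} (Lq_integrand \<tau> \<eta>))"

text \<open>\<open>L\<close> is \<open>L\<^sub>q\<close> as a function of \<open>w = ln \<eta>\<close>: the analytic continuation of the integral. Its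
  branch points are logarithmic and lie at \<open>w = \<plusminus> i (\<pi> + (2a+1)\<bar>\<tau>\<bar> + 2\<pi>b)\<close> with integers
  \<open>a, b \<ge> 0\<close>, so that \<open>e\<^sup>w = - q\<^sup>n\<close> with \<open>n\<close> odd. The plane is cut along the half-lines
  \<open>Re w = 0\<close>, \<open>\<bar>Im w\<bar> \<ge> \<pi> + \<bar>\<tau>\<bar>\<close>; on a cut \<open>L\<close> takes its limit from \<open>Re w < 0\<close>. (The limits from
  the two sides differ by integer multiples of \<open>2\<pi>i\<close>, so \<open>exp L\<close> does not depend on this
  choice.)\<close>

definition is_Lq :: "complex \<Rightarrow> (complex \<Rightarrow> complex) \<Rightarrow> bool" where
  "is_Lq q L \<longleftrightarrow>
     (\<forall>\<eta>>0. L (of_real (ln \<eta>)) = Lq_integral (Arg q) \<eta>) \<and>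
     L holomorphic_on {w. Re w \<noteq> 0 \<or> \<bar>Im w\<bar> < pi + \<bar>Arg q\<bar>} \<and>
     continuous_on {w. Re w \<le> 0 \<and> (\<forall>n::int. odd n \<longrightarrow> exp w \<noteq> - (q powi n))} L"

end

theory Submission
  imports Defs "HOL-Complex_Analysis.Complex_Analysis"
begin

text \<open>
  The products in (i) and (ii) telescope under \<open>\<eta> \<mapsto> q\<^sup>2\<eta>\<close>. For (iii), put \<open>\<tau> = Arg q\<close>,
  \<open>a = \<bar>\<tau>\<bar>/\<pi>\<close> and substitute \<open>t = e\<^sup>s\<close>: up to the factor \<open>\<plusminus>1/(2\<pi>i)\<close>, \<open>L\<^sub>q\<close> is the integral of
  \<open>Ln (1 + e\<^bsup>w+as\<^esup>) / (1 + e\<^sup>s)\<close> over the real line, which is holomorphic for \<open>\<bar>Im w\<bar> < \<pi>\<close>.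
  The values at \<open>w \<plusminus> ia\<pi>\<close> are the integrals of \<open>Ln (1 + e\<^bsup>w+as\<^esup>) / (1 - e\<^sup>s)\<close> over the lines
  \<open>Im s = \<plusminus>\<pi>\<close>, so they differ by the residue at \<open>s = 0\<close>; this is the difference equation.
  The strip is wider than the step \<open>2\<bar>\<tau>\<bar>\<close> of the equation, which therefore continues \<open>L\<^sub>q\<close> to the
  cut plane. On the closed left half-plane every logarithm involved is principal, which gives
  continuity there. For an arbitrary \<open>L\<close> with these properties, the exponentiated equation
  \<open>exp (L (w + i\<tau>) - L (w - i\<tau>)) = 1 + e\<^sup>w\<close> follows off the imaginary axis from the identity theorem
  and on the axis by taking limits from the left. Its instances at \<open>w\<close> and \<open>w - 2Ji\<tau>\<close> give the
  equation for \<open>Q\<close>.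
\<close>

section \<open>The functional equation and the product solutions\<close>

text \<open>The quotient of two solutions is invariant because the coefficients cancel, and it is
  defined because \<open>Q0\<close> never vanishes on the domain. For a candidate it therefore
  suffices to check nonvanishing and the equation.\<close>

lemma Q_given_byI:
  assumes "q \<noteq> 0"
    and nz: "\<And>\<eta>. \<eta> \<in> eta_dom q J \<Longrightarrow> Q0 \<eta> \<noteq> 0"
    and eq: "\<And>\<eta>. \<eta> \<in> eta_dom q J \<Longrightarrow>
      Q0 (q\<^sup>2 * \<eta>) * (1 + \<eta>) = Q0 \<eta> * (1 + q powr of_real (- 2 * J) * \<eta>)"
  shows "Q_given_by q J Q0"
proof -
  have nz': "1 + \<eta> \<noteq> 0" if "\<eta> \<in> eta_dom q J" for \<eta>
    using that unfolding eta_dom_def by (auto dest: spec[of _ 0])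
  have "Q_equation q J Q \<longleftrightarrow>
        (\<exists>f. (\<forall>\<eta>\<in>eta_dom q J. f (q\<^sup>2 * \<eta>) = f \<eta>) \<and> (\<forall>\<eta>\<in>eta_dom q J. Q \<eta> = f \<eta> * Q0 \<eta>))"
    (is "?L \<longleftrightarrow> ?R") for Q
  proof
    assume Q: ?L
    have "Q (q\<^sup>2 * \<eta>) / Q0 (q\<^sup>2 * \<eta>) = Q \<eta> / Q0 \<eta>" if \<eta>: "\<eta> \<in> eta_dom q J" for \<eta>
    proof -
      let ?c = "1 + q powr of_real (- 2 * J) * \<eta>"
      have "Q (q\<^sup>2 * \<eta>) * Q0 \<eta> * (1 + \<eta>) = Q \<eta> * Q0 \<eta> * ?c"
        using Q \<eta> by (simp add: Q_equation_def mult_ac)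
      also have "\<dots> = Q \<eta> * Q0 (q\<^sup>2 * \<eta>) * (1 + \<eta>)"
        using eq[OF \<eta>] by (simp add: mult_ac)
      finally have "Q (q\<^sup>2 * \<eta>) * Q0 \<eta> = Q \<eta> * Q0 (q\<^sup>2 * \<eta>)"
        using nz'[OF \<eta>] by simp
      then show ?thesis
        using nz[OF \<eta>] nz[OF eta_dom_invariant[OF \<open>q \<noteq> 0\<close> \<eta>]]
        by (simp add: divide_simps mult_ac)
    qed
    then show ?R
      using nz by (intro exI[of _ "\<lambda>\<eta>. Q \<eta> / Q0 \<eta>"]) auto
  next
    assume ?R
    then show ?L
      using eq eta_dom_invariant[OF \<open>q \<noteq> 0\<close>]
      by (auto simp: Q_equation_def mult.assoc)
  qed
  then show ?thesis
    unfolding Q_given_by_def using nz eq by (auto simp: Q_equation_def)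
qed

text \<open>Carries the invariance of \<open>eta_dom\<close> over to the coordinate \<open>w\<close>
  with \<open>\<eta> = exp w\<close>.\<close>

lemma exp_double_step:
  assumes "norm q = 1"
  shows "exp (w + 2 * \<i> * of_real (Arg q)) = q\<^sup>2 * exp w"
proof -
  have "q = exp (\<i> * of_real (Arg q))"
    using assms by (metis Arg_eq mult_1 norm_eq_zero of_real_1 zero_neq_one)
  then have "q\<^sup>2 = exp (2 * (\<i> * of_real (Arg q)))"
    by (metis exp_double)
  then show ?thesis
    by (simp add: exp_add mult_ac)
qed

text \<open>The argument of \<open>Q_given_byI\<close> with a shift of \<open>w\<close>. The
  invariant factor may be a genuine function of \<open>w\<close>: no period \<open>2 \<pi> i\<close>
  is imposed on it.\<close>

lemma Q_given_by_logI:
  assumes q: "norm q = 1"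
    and nz: "\<And>w. exp w \<in> eta_dom q J \<Longrightarrow> Q0 w \<noteq> 0"
    and eq: "\<And>w. exp w \<in> eta_dom q J \<Longrightarrow>
      Q0 (w + 2 * \<i> * of_real (Arg q)) * (1 + exp w) =
      Q0 w * (1 + q powr of_real (- 2 * J) * exp w)"
  shows "Q_given_by_log q J Q0"
proof -
  let ?s = "2 * \<i> * of_real (Arg q)"
  have "q \<noteq> 0" using q by auto
  have inv: "exp (w + ?s) \<in> eta_dom q J" if "exp w \<in> eta_dom q J" for w
    unfolding exp_double_step[OF q] by (rule eta_dom_invariant[OF \<open>q \<noteq> 0\<close> that])
  have nz': "1 + exp w \<noteq> 0" if "exp w \<in> eta_dom q J" for w
    using that unfolding eta_dom_def by (auto dest: spec[of _ 0])
  have "Q_equation_log q J Q \<longleftrightarrow>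
        (\<exists>f. (\<forall>w. exp w \<in> eta_dom q J \<longrightarrow> f (w + ?s) = f w) \<and>
             (\<forall>w. exp w \<in> eta_dom q J \<longrightarrow> Q w = f w * Q0 w))"
    (is "?L \<longleftrightarrow> ?R") for Q
  proof
    assume Q: ?L
    have "Q (w + ?s) / Q0 (w + ?s) = Q w / Q0 w" if w: "exp w \<in> eta_dom q J" for w
    proof -
      let ?c = "1 + q powr of_real (- 2 * J) * exp w"
      have "Q (w + ?s) * Q0 w * (1 + exp w) = Q w * Q0 w * ?c"
        using Q w by (simp add: Q_equation_log_def mult_ac)
      also have "\<dots> = Q w * Q0 (w + ?s) * (1 + exp w)"
        using eq[OF w] by (simp add: mult_ac)
      finally have "Q (w + ?s) * Q0 w = Q w * Q0 (w + ?s)"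
        using nz'[OF w] by simp
      then show ?thesis
        using nz[OF w] nz[OF inv[OF w]] by (simp add: divide_simps mult_ac)
    qed
    then show ?R
      using nz by (intro exI[of _ "\<lambda>w. Q w / Q0 w"]) auto
  next
    assume ?R
    then show ?L
      using eq inv by (auto simp: Q_equation_log_def mult.assoc)
  qed
  then show ?thesis
    unfolding Q_given_by_log_def using nz eq by (auto simp: Q_equation_log_def)
qed

lemma powr_of_real_int:
  fixes q :: complex
  assumes "q \<noteq> 0" "x = of_int n"
  shows "q powr of_real x = q powi n"
  using assms complex_powr_of_int[of q n] by simp

lemma powr_of_real_add:
  fixes q :: complex
  shows "q powr of_real (x + y) = q powr of_real x * q powr of_real y"
  by (simp only: of_real_add powr_add)

text \<open>Every factor in the finite and infinite products has one of these two forms, with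
  \<open>n\<close> of either sign, so excluding whole orbits keeps all of them nonzero.\<close>

lemma eta_dom_factor_nonzero:
  assumes "q \<noteq> 0" "\<eta> \<in> eta_dom q J"
  shows "1 + q powr of_real (2 * of_int n) * \<eta> \<noteq> 0"
    and "1 + q powr of_real (- 2 * J + 2 * of_int n) * \<eta> \<noteq> 0"
proof -
  have *: "q powr of_real (2 * of_int n) = q powi (2 * n)"
    using powr_of_real_int[OF assms(1), of "2 * of_int n" "2 * n"] by simp
  then show "1 + q powr of_real (2 * of_int n) * \<eta> \<noteq> 0"
    using assms(2) unfolding eta_dom_def by auto
  have "q powr of_real (- 2 * J + 2 * of_int n) = q powr of_real (- 2 * J) * q powi (2 * n)"
    unfolding *[symmetric] by (rule powr_of_real_add)
  then show "1 + q powr of_real (- 2 * J + 2 * of_int n) * \<eta> \<noteq> 0"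
    using assms(2) unfolding eta_dom_def by (auto simp: mult.assoc)
qed

section \<open>Telescoping products\<close>

text \<open>Multiplying \<open>\<eta>\<close> by \<open>q\<^sup>2\<close> raises the index of each
  factor by one. The product thus exchanges its first factor for the one following its last, and
  these two are the coefficients of the equation.\<close>

lemma Q_given_by_integer:
  assumes "q \<noteq> 0"
  shows "Q_given_by q (real n)
    (\<lambda>\<eta>. \<Prod>k<n. 1 / (1 + \<eta> * q powr of_real (- 2 * real n + 2 * real k)))"
proof (rule Q_given_byI[OF assms])
  fix \<eta> assume \<eta>: "\<eta> \<in> eta_dom q (real n)"
  \<comment> \<open>Also used at \<open>k = n\<close>, outside the product, where it equals
    \<open>1 + \<eta>\<close>.\<close>
  define g where "g k = 1 + \<eta> * q powr of_real (- 2 * real n + 2 * real k)" for k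
  have g: "g k \<noteq> 0" for k
    using eta_dom_factor_nonzero(2)[OF assms \<eta>, of "int k"] by (simp add: g_def mult_ac)
  have "(\<Prod>k<n. 1 / g k) \<noteq> 0" using g by (simp add: prod_zero_iff)
  then show "(\<Prod>k<n. 1 / (1 + \<eta> * q powr of_real (- 2 * real n + 2 * real k))) \<noteq> 0"
    by (simp add: g_def)
  have shift: "1 + q\<^sup>2 * \<eta> * q powr of_real (- 2 * real n + 2 * real k) = g (Suc k)" for k
  proof -
    have "q powr of_real (- 2 * real n + 2 * real (Suc k))
        = q powr of_real (- 2 * real n + 2 * real k) * q powr of_real 2"
      unfolding powr_of_real_add[symmetric] by (rule arg_cong) simp
    also have "q powr of_real 2 = q\<^sup>2"
      using powr_of_real_int[OF assms, of 2 2] by simp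
    finally show ?thesis by (simp add: g_def mult_ac)
  qed
  have "(\<Prod>k<n. 1 / g (Suc k)) * g n = (\<Prod>k<n. 1 / g k) * g 0"
  proof -
    have "(\<Prod>k<n. 1 / g (Suc k)) * (1 / g 0) = (\<Prod>k<Suc n. 1 / g k)"
      by (subst prod.lessThan_Suc_shift) (simp add: mult.commute)
    then have "(\<Prod>k<n. 1 / g (Suc k)) * (1 / g 0) = (\<Prod>k<n. 1 / g k) * (1 / g n)"
      by simp
    then show ?thesis using g[of 0] g[of n] by (simp add: field_simps)
  qed
  moreover have "g n = 1 + \<eta>" using assms by (simp add: g_def)
  moreover have "g 0 = 1 + q powr of_real (- 2 * real n) * \<eta>" by (simp add: g_def mult_ac)
  ultimately show "(\<Prod>k<n. 1 / (1 + q\<^sup>2 * \<eta> * q powr of_real (- 2 * real n + 2 * real k))) * (1 + \<eta>)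
    = (\<Prod>k<n. 1 / (1 + \<eta> * q powr of_real (- 2 * real n + 2 * real k)))
        * (1 + q powr of_real (- 2 * real n) * \<eta>)"
    unfolding shift g_def[symmetric] by (simp only:)
qed

text \<open>Numerators and denominators each differ from 1 by a summable geometric sequence, so both
  products converge, and with them the quotient.\<close>

lemma convergent_prod_geometric_quotient:
  fixes a b p :: complex
  assumes "norm p < 1" "\<And>k. 1 + a * p ^ k \<noteq> 0" "\<And>k. 1 + b * p ^ k \<noteq> 0"
  shows "convergent_prod (\<lambda>k. (1 + a * p ^ k) / (1 + b * p ^ k))"
proof -
  have "convergent_prod (\<lambda>k. 1 + c * p ^ k)" if "\<And>k. 1 + c * p ^ k \<noteq> 0" for c
  proof (rule summable_imp_convergent_prod_complex)
    show "summable (\<lambda>k. norm (c * p ^ k))"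
      unfolding norm_mult norm_power
      using assms(1) by (intro summable_mult summable_geometric) simp
    show "c * p ^ k \<noteq> -1" for k
      using that[of k] by (metis add.right_inverse)
  qed
  then show ?thesis
    using assms(2,3) by (intro convergent_prod_divide) auto
qed

lemma pos_real_cases:
  assumes "pos_real q"
  obtains r where "q = complex_of_real r" "0 < r"
  using assms by (auto simp: pos_real_def Reals_def)

text \<open>The factors are governed by powers of \<open>q\<^sup>2\<close>, of modulus below 1. The
  step in \<open>\<eta>\<close> removes the first factor,
  \<open>(1 + \<eta>) / (1 + q powr (- 2 J) \<eta>)\<close>, which is the functional
  equation.\<close>

lemma Q_given_by_prodinf_small:
  fixes J :: real
  defines "F \<equiv> \<lambda>q \<eta> k. (1 + q powr of_real (2 * real k) * \<eta>)
                        / (1 + q powr of_real (- 2 * J + 2 * real k) * \<eta> :: complex)"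
  assumes q: "q \<noteq> 0" "norm q < 1"
  shows "\<forall>\<eta>\<in>eta_dom q J. convergent_prod (F q \<eta>)"
    and "Q_given_by q J (\<lambda>\<eta>. \<Prod>k. F q \<eta> k)"
proof -
  have p: "q powr of_real (c + 2 * real k) = q powr of_real c * (q\<^sup>2) ^ k" for c k
  proof -
    have "q powr of_real (c + 2 * real k) = q powr of_real c * q powr of_real (2 * real k)"
      by (rule powr_of_real_add)
    also have "q powr of_real (2 * real k) = (q\<^sup>2) ^ k"
      using powr_of_real_int[OF q(1), of "2 * real k" "int (2 * k)"]
      unfolding power_int_of_nat power_mult by simp
    finally show ?thesis .
  qed
  have p0: "q powr of_real (2 * real k) = (q\<^sup>2) ^ k" for k
    using p[of 0 k] q(1) by simp
  have F: "F q \<eta> = (\<lambda>k. (1 + \<eta> * (q\<^sup>2) ^ k) / (1 + q powr of_real (- 2 * J) * \<eta> * (q\<^sup>2) ^ k))" for \<eta>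
    unfolding F_def p p0 by (simp add: mult_ac)
  have nz: "1 + \<eta> * (q\<^sup>2) ^ k \<noteq> 0" "1 + q powr of_real (- 2 * J) * \<eta> * (q\<^sup>2) ^ k \<noteq> 0"
    if "\<eta> \<in> eta_dom q J" for \<eta> k
    using eta_dom_factor_nonzero[OF q(1) that, of "int k"] p[of "- 2 * J" k] p0[of k]
    by (simp_all add: mult_ac)
  have conv: "convergent_prod (F q \<eta>)" if "\<eta> \<in> eta_dom q J" for \<eta>
    unfolding F
    by (rule convergent_prod_geometric_quotient)
       (use q nz[OF that] in \<open>auto simp: norm_power power_less_one_iff\<close>)
  then show "\<forall>\<eta>\<in>eta_dom q J. convergent_prod (F q \<eta>)" by blast
  show "Q_given_by q J (\<lambda>\<eta>. \<Prod>k. F q \<eta> k)"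
  proof (rule Q_given_byI[OF q(1)])
    fix \<eta> assume \<eta>: "\<eta> \<in> eta_dom q J"
    have F0: "F q \<eta> k \<noteq> 0" for k using nz[OF \<eta>] by (simp add: F)
    show "(\<Prod>k. F q \<eta> k) \<noteq> 0"
      using prodinf_nonzero[OF conv[OF \<eta>] F0] .
    have "F q (q\<^sup>2 * \<eta>) k = F q \<eta> (Suc k)" for k
      by (simp add: F mult_ac)
    then have "(\<Prod>k. F q (q\<^sup>2 * \<eta>) k) = (\<Prod>k. F q \<eta> k) / F q \<eta> 0"
      using prodinf_split_head[OF conv[OF \<eta>] F0] by simp
    then show "(\<Prod>k. F q (q\<^sup>2 * \<eta>) k) * (1 + \<eta>)
      = (\<Prod>k. F q \<eta> k) * (1 + q powr of_real (- 2 * J) * \<eta>)"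
      using nz[OF \<eta>, of 0] by (simp add: F)
  qed
qed

text \<open>Now the inverse of \<open>q\<^sup>2\<close> is the small ratio, and the step in
  \<open>\<eta>\<close> lowers the index: the product gains a new first factor instead of losing
  one.\<close>

lemma Q_given_by_prodinf_large:
  fixes J :: real
  defines "F \<equiv> \<lambda>q \<eta> k. (1 + q powr of_real (- 2 * J - 2 * real k - 2) * \<eta>)
                        / (1 + q powr of_real (- 2 * real k - 2) * \<eta> :: complex)"
  assumes q: "1 < norm q"
  shows "\<forall>\<eta>\<in>eta_dom q J. convergent_prod (F q \<eta>)"
    and "Q_given_by q J (\<lambda>\<eta>. \<Prod>k. F q \<eta> k)"
proof -
  have q0: "q \<noteq> 0" using q by auto
  define p where "p = inverse (q\<^sup>2)"
  have p: "q powr of_real (c - 2 * real k - 2) = q powr of_real c * p ^ Suc k" for c k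
  proof -
    have "q powr of_real (c - 2 * real k - 2)
        = q powr of_real c * q powr of_real (- 2 * real k - 2)"
      unfolding powr_of_real_add[symmetric] by (rule arg_cong) simp
    also have "q powr of_real (- 2 * real k - 2) = q powi (- int (2 * Suc k))"
      using powr_of_real_int[OF q0, of "- 2 * real k - 2" "- int (2 * Suc k)"] by simp
    also have "\<dots> = p ^ Suc k"
      by (simp only: p_def power_int_minus power_int_of_nat power_mult power_inverse)
    finally show ?thesis .
  qed
  have p0: "q powr of_real (- 2 * real k - 2) = p ^ Suc k" for k
    using p[of 0 k] q0 by simp
  have F: "F q \<eta> = (\<lambda>k. (1 + q powr of_real (- 2 * J) * \<eta> * p * p ^ k) / (1 + \<eta> * p * p ^ k))" for \<eta>
    unfolding F_def p p0 by (simp add: mult_ac)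
  have nz: "1 + \<eta> * p * p ^ k \<noteq> 0" "1 + q powr of_real (- 2 * J) * \<eta> * p * p ^ k \<noteq> 0"
    if "\<eta> \<in> eta_dom q J" for \<eta> k
    using eta_dom_factor_nonzero[OF q0 that, of "- int k - 1"] p[of "- 2 * J" k] p0[of k]
    by (simp_all add: mult_ac algebra_simps)
  have conv: "convergent_prod (F q \<eta>)" if "\<eta> \<in> eta_dom q J" for \<eta>
    unfolding F
  proof (rule convergent_prod_geometric_quotient)
    show "norm p < 1"
      using q by (simp add: p_def norm_inverse norm_power inverse_less_1_iff)
  qed (use nz[OF that] in auto)
  then show "\<forall>\<eta>\<in>eta_dom q J. convergent_prod (F q \<eta>)" by blast
  show "Q_given_by q J (\<lambda>\<eta>. \<Prod>k. F q \<eta> k)"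
  proof (rule Q_given_byI[OF q0])
    fix \<eta> assume \<eta>: "\<eta> \<in> eta_dom q J"
    note \<eta>' = eta_dom_invariant[OF q0 \<eta>]
    have F0: "F q \<eta> k \<noteq> 0" for k using nz[OF \<eta>] by (simp add: F)
    have F0': "F q (q\<^sup>2 * \<eta>) k \<noteq> 0" for k using nz[OF \<eta>'] by (simp add: F)
    show "(\<Prod>k. F q \<eta> k) \<noteq> 0"
      using prodinf_nonzero[OF conv[OF \<eta>] F0] .
    have pq: "p * q\<^sup>2 = 1" using q0 by (simp add: p_def)
    have "F q (q\<^sup>2 * \<eta>) (Suc k) = F q \<eta> k" for k
    proof -
      \<comment> \<open>Instantiated with 1 for the denominator and with
        \<open>q powr (- 2 J)\<close> for the numerator.\<close>
      have "c * (q\<^sup>2 * \<eta>) * p * p ^ Suc k = c * \<eta> * p * p ^ k * (p * q\<^sup>2)" for c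
        by (simp add: mult_ac)
      from this[of 1] this[of "q powr of_real (- 2 * J)"] show ?thesis
        unfolding F pq by (simp only: mult_1_left mult_1_right)
    qed
    then have "(\<Prod>k. F q \<eta> k) = (\<Prod>k. F q (q\<^sup>2 * \<eta>) k) / F q (q\<^sup>2 * \<eta>) 0"
      using prodinf_split_head[OF conv[OF \<eta>'] F0'] by simp
    moreover have "F q (q\<^sup>2 * \<eta>) 0 = (1 + q powr of_real (- 2 * J) * \<eta>) / (1 + \<eta>)"
    proof -
      have "c * (q\<^sup>2 * \<eta>) * p = c * \<eta> * (p * q\<^sup>2)" for c
        by (simp add: mult_ac)
      from this[of 1] this[of "q powr of_real (- 2 * J)"] show ?thesis
        unfolding F pq by (simp only: mult_1_left mult_1_right power_0)
    qed
    moreover have "1 + \<eta> \<noteq> 0" "1 + q powr of_real (- 2 * J) * \<eta> \<noteq> 0"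
      using eta_dom_factor_nonzero[OF q0 \<eta>, of 0] q0 by simp_all
    ultimately show "(\<Prod>k. F q (q\<^sup>2 * \<eta>) k) * (1 + \<eta>)
      = (\<Prod>k. F q \<eta> k) * (1 + q powr of_real (- 2 * J) * \<eta>)"
      by simp
  qed
qed


section \<open>The integral on the strip\<close>

text \<open>In this strip \<open>exp z\<close> is real only on the real axis, where it is positive.
  Hence the principal logarithm in the integrand stays off its cut.\<close>

lemma one_plus_exp_notin_nonpos_Reals:
  assumes "\<bar>Im z\<bar> < pi"
  shows "1 + exp z \<notin> \<real>\<^sub>\<le>\<^sub>0"
proof
  assume *: "1 + exp z \<in> \<real>\<^sub>\<le>\<^sub>0"
  then have "sin (Im z) = 0"
    by (auto simp: complex_nonpos_Reals_iff Im_exp)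
  then have "Im z = 0"
    using assms sin_zero_pi_iff by blast
  then have "Re (1 + exp z) > 0"
    by (simp add: Re_exp add_pos_pos)
  with * show False
    by (auto simp: complex_nonpos_Reals_iff)
qed

text \<open>With \<open>r = exp (Re z)\<close> the squared norm is at least
  \<open>1 + 2 r cos \<beta> + r\<^sup>2\<close>, which is
  \<open>(r + cos \<beta>)\<^sup>2 + (sin \<beta>)\<^sup>2\<close>.\<close>

lemma norm_one_plus_exp_ge:
  assumes "\<bar>Im z\<bar> \<le> \<beta>" "\<beta> \<le> pi"
  shows "sin \<beta> \<le> norm (1 + exp z)"
proof -
  define r where "r = exp (Re z)"
  have "cos \<beta> \<le> cos (Im z)"
    using assms cos_monotone_0_pi_le[of "\<bar>Im z\<bar>" \<beta>] by (simp add: cos_abs_real)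
  then have "2 * r * cos \<beta> \<le> 2 * r * cos (Im z)"
    by (simp add: r_def)
  moreover have "(sin \<beta>)\<^sup>2 + (cos \<beta>)\<^sup>2 = 1"
    by simp
  moreover have "(norm (1 + exp z))\<^sup>2 = (1 + r * cos (Im z))\<^sup>2 + (r * sin (Im z))\<^sup>2"
    by (simp add: cmod_power2 Re_exp Im_exp r_def)
  moreover have "(1 + r * cos (Im z))\<^sup>2 + (r * sin (Im z))\<^sup>2
      = 1 + 2 * r * cos (Im z) + r\<^sup>2"
    using sin_cos_squared_add[of "Im z"] by algebra
  moreover have "(r + cos \<beta>)\<^sup>2 = r\<^sup>2 + 2 * r * cos \<beta> + (cos \<beta>)\<^sup>2"
    by (simp add: power2_eq_square algebra_simps)
  moreover have "0 \<le> (r + cos \<beta>)\<^sup>2" by simp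
  ultimately have "(sin \<beta>)\<^sup>2 \<le> (norm (1 + exp z))\<^sup>2"
    by linarith
  then show ?thesis
    by (rule power2_le_imp_le) simp
qed

text \<open>Mean value inequality for \<open>Ln (1 + x)\<close> on the segment from 0 to
  \<open>exp z\<close>, with the lower bound for \<open>1 + x\<close> controlling the
  derivative.\<close>

lemma norm_Ln_one_plus_exp_le:
  assumes "\<bar>Im z\<bar> \<le> \<beta>" "0 < \<beta>" "\<beta> < pi"
  shows "norm (Ln (1 + exp z)) \<le> exp (Re z) / sin \<beta>"
proof -
  have sin: "0 < sin \<beta>" using assms by (intro sin_gt_zero) auto
  have *: "1 + x \<notin> \<real>\<^sub>\<le>\<^sub>0 \<and> sin \<beta> \<le> norm (1 + x)" if "x \<in> closed_segment 0 (exp z)" for x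
  proof -
    obtain u where u: "0 \<le> u" "u \<le> 1" "x = of_real u * exp z"
      using \<open>x \<in> closed_segment 0 (exp z)\<close> by (auto simp: in_segment scaleR_conv_of_real)
    show ?thesis
    proof (cases "u = 0")
      case True
      then show ?thesis using u by simp
    next
      case False
      \<comment> \<open>Scaling by \<open>u\<close> adds a real number to the exponent and keeps its
        imaginary part, so the preceding estimates apply along the whole segment.\<close>
      then have "x = exp (z + of_real (ln u))"
        using u by (simp add: exp_add exp_of_real mult.commute)
      then show ?thesis
        using one_plus_exp_notin_nonpos_Reals[of "z + of_real (ln u)"]
          norm_one_plus_exp_ge[of "z + of_real (ln u)" \<beta>] assms by simp
    qed
  qed
  have "norm (Ln (1 + exp z) - Ln (1 + 0)) \<le> (1 / sin \<beta>) * norm (exp z - 0)"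
  proof (rule field_differentiable_bound[where f = "\<lambda>x. Ln (1 + x)" and f' = "\<lambda>x. 1 / (1 + x)"
        and S = "closed_segment 0 (exp z)"])
    fix x assume x: "x \<in> closed_segment 0 (exp z)"
    show "((\<lambda>x. Ln (1 + x)) has_field_derivative 1 / (1 + x)) (at x within closed_segment 0 (exp z))"
      using *[OF x] by (auto intro!: derivative_eq_intros simp: divide_inverse)
    show "norm (1 / (1 + x)) \<le> 1 / sin \<beta>"
      unfolding norm_divide using *[OF x] sin by (auto intro!: divide_left_mono mult_pos_pos)
  qed auto
  then show ?thesis by simp
qed

lemma integrable_exp_minus_abs:
  assumes "0 < c"
  shows "(\<lambda>s::real. exp (- c * \<bar>s\<bar>)) integrable_on UNIV"
proof -
  have 1: "(\<lambda>s. exp (- c * \<bar>s\<bar>)) integrable_on {0..}"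
    using integrable_on_exp_minus_to_infinity[OF assms, of 0]
    by (rule integrable_eq) simp
  have 2: "(\<lambda>s. exp (- c * \<bar>s\<bar>)) integrable_on {..0}"
  proof -
    let ?f = "\<lambda>s::real. exp (- c * \<bar>s\<bar>)"
    have "?f absolutely_integrable_on {0..}"
      using 1 by (intro nonnegative_absolutely_integrable_1) auto
    then have "?f absolutely_integrable_on uminus ` {0..}"
      by (subst absolutely_integrable_change_of_variables_1'[where h = "\<lambda>_. -1"])
         (auto intro!: derivative_eq_intros injI)
    then show ?thesis
      by (simp add: absolutely_integrable_on_def)
  qed
  have "(\<lambda>s. exp (- c * \<bar>s\<bar>)) integrable_on ({0..} \<union> {..0})"
    by (rule integrable_Un[OF _ 1 2]) (auto intro: negligible_subset[of "{0}"])
  moreover have "{0..} \<union> {..0::real} = UNIV" by auto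
  ultimately show ?thesis by simp
qed

section \<open>Truncation of integrals over the line\<close>

text \<open>Both tails are integrals over the line of functions set to zero on
  \<open>{a..b}\<close>, so domination passes to them. A common majorant then makes truncation
  errors locally uniform in a parameter.\<close>

lemma norm_integral_tail_le:
  fixes f :: "real \<Rightarrow> complex"
  assumes f: "f integrable_on UNIV" and h: "h integrable_on UNIV"
    and le: "\<And>x. norm (f x) \<le> h x"
  shows "norm (integral UNIV f - integral {a..b} f) \<le> integral UNIV h - integral {a..b} h"
proof -
  have *: "((\<lambda>x. g x - (if x \<in> {a..b} then g x else 0)) has_integral
      integral UNIV g - integral {a..b} g) UNIV"
    if "g integrable_on UNIV" for g :: "real \<Rightarrow> 'b::euclidean_space"
  proof (rule has_integral_diff)
    have "g integrable_on {a..b}"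
      using that integrable_on_subinterval by blast
    then show "((\<lambda>x. if x \<in> {a..b} then g x else 0) has_integral integral {a..b} g) UNIV"
      by (simp only: has_integral_restrict_UNIV integrable_integral)
  qed (use that integrable_integral in blast)
  show ?thesis
    unfolding integral_unique[OF *[OF f], symmetric] integral_unique[OF *[OF h], symmetric]
  proof (rule integral_norm_bound_integral)
    show "norm (f x - (if x \<in> {a..b} then f x else 0)) \<le> h x - (if x \<in> {a..b} then h x else 0)" for x
      using le[of x] by auto
  qed (use *[OF f] *[OF h] in \<open>auto intro: has_integral_integrable\<close>)
qed

lemma integral_symmetric_tendsto:
  fixes h :: "real \<Rightarrow> real"
  assumes h: "h integrable_on UNIV" and "\<And>x. 0 \<le> h x"
  shows "(\<lambda>n. integral {- real n..real n} h) \<longlonglongrightarrow> integral UNIV h"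
proof -
  have "(\<lambda>n. integral UNIV (\<lambda>x. if x \<in> {- real n..real n} then h x else 0)) \<longlonglongrightarrow> integral UNIV h"
  proof (rule dominated_convergence(2)[where h = h])
    show "(\<lambda>x. if x \<in> {- real n..real n} then h x else 0) integrable_on UNIV" for n
      using integrable_on_subinterval[OF h subset_UNIV, of "- real n" "real n"]
      by (simp only: integrable_restrict_UNIV)
    show "norm (if x \<in> {- real n..real n} then h x else 0) \<le> h x" for n x
      using assms(2)[of x] by simp
    show "(\<lambda>n. if x \<in> {- real n..real n} then h x else 0) \<longlonglongrightarrow> h x" for x
    proof (rule tendsto_eventually)
      obtain N where N: "\<bar>x\<bar> \<le> real N" using real_arch_simple by blast
      show "\<forall>\<^sub>F n in sequentially. (if x \<in> {- real n..real n} then h x else 0) = h x"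
        using eventually_ge_at_top[of N] by eventually_elim (use N in auto)
    qed
  qed (use h in auto)
  then show ?thesis by (simp only: integral_restrict_UNIV)
qed

section \<open>The transformed integrand and its majorant\<close>

text \<open>The integrand of \<open>Lq_integral\<close> after \<open>t = exp s\<close> and
  \<open>\<eta> = exp w\<close>, with \<open>a = \<bar>\<tau>\<bar> / pi\<close>: the measure
  \<open>dt / t\<close> becomes \<open>ds\<close>. The prefactor is left out.\<close>

definition Lkernel :: "real \<Rightarrow> complex \<Rightarrow> real \<Rightarrow> complex" where
  "Lkernel a w s = Ln (1 + exp (w + of_real (a * s))) / of_real (1 + exp s)"

definition Lstrip :: "real \<Rightarrow> complex \<Rightarrow> complex" where
  "Lstrip a w = integral UNIV (Lkernel a w)"

text \<open>Dropping 1 from the denominator gives the decay rate \<open>1 - a\<close> on the right;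
  dropping \<open>exp s\<close> gives the rate \<open>a\<close> on the left. The smaller rate serves
  both.\<close>

lemma exp_quotient_le:
  fixes a s :: real
  assumes "0 < a" "a < 1"
  shows "exp (a * s) / (1 + exp s) \<le> exp (- min a (1 - a) * \<bar>s\<bar>)"
proof (cases "0 \<le> s")
  case True
  have "exp (a * s) / (1 + exp s) \<le> exp (a * s) / exp s"
    by (intro divide_left_mono mult_pos_pos add_pos_pos) auto
  also have "\<dots> = exp (- (1 - a) * s)" by (simp add: exp_diff[symmetric] algebra_simps)
  also have "\<dots> \<le> exp (- min a (1 - a) * \<bar>s\<bar>)"
    using True mult_right_mono[of "min a (1 - a)" "1 - a" s] by (simp add: left_diff_distrib)
  finally show ?thesis .
next
  case False
  have "exp (a * s) / (1 + exp s) \<le> exp (a * s) / 1"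
    by (intro divide_left_mono mult_pos_pos add_pos_pos) auto
  also have "\<dots> \<le> exp (- min a (1 - a) * \<bar>s\<bar>)"
    using False mult_right_mono_neg[of "min a (1 - a)" a s] by simp
  finally show ?thesis .
qed

text \<open>The term \<open>a * s\<close> is real, so the same \<open>\<beta>\<close> works for all
  \<open>s\<close>. The bound depends on \<open>w\<close> only through \<open>Re w\<close> and
  \<open>\<beta>\<close>.\<close>

lemma norm_Lkernel_le:
  assumes a: "0 < a" "a < 1" and w: "\<bar>Im w\<bar> \<le> \<beta>" "0 < \<beta>" "\<beta> < pi"
  shows "norm (Lkernel a w s) \<le> exp (Re w) / sin \<beta> * exp (- min a (1 - a) * \<bar>s\<bar>)"
proof -
  have sin: "0 < sin \<beta>" using w by (intro sin_gt_zero) auto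
  have "norm (Lkernel a w s) = norm (Ln (1 + exp (w + of_real (a * s)))) / (1 + exp s)"
    unfolding Lkernel_def norm_divide norm_of_real by (simp add: add_pos_pos)
  also have "\<dots> \<le> (exp (Re (w + of_real (a * s))) / sin \<beta>) / (1 + exp s)"
    using w by (intro divide_right_mono norm_Ln_one_plus_exp_le) (auto intro: add_nonneg_nonneg)
  also have "\<dots> = exp (Re w) / sin \<beta> * (exp (a * s) / (1 + exp s))"
    by (simp add: exp_add)
  also have "\<dots> \<le> exp (Re w) / sin \<beta> * exp (- min a (1 - a) * \<bar>s\<bar>)"
    using exp_quotient_le[OF a] sin by (intro mult_left_mono) auto
  finally show ?thesis .
qed

lemma continuous_on_Lkernel:
  assumes "\<bar>Im w\<bar> < pi"
  shows "continuous_on S (Lkernel a w)"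
proof -
  have "1 + exp s \<noteq> 0" for s :: real
    by (metis add_pos_pos exp_gt_zero less_irrefl zero_less_one)
  moreover have "1 + exp (w + of_real (a * s)) \<notin> \<real>\<^sub>\<le>\<^sub>0" for s
    using assms by (intro one_plus_exp_notin_nonpos_Reals) simp
  ultimately show ?thesis
    unfolding Lkernel_def
    by (intro continuous_intros) (auto simp del: of_real_add)
qed

lemma absolutely_integrable_Lkernel:
  assumes a: "0 < a" "a < 1" and w: "\<bar>Im w\<bar> < pi"
  shows "Lkernel a w absolutely_integrable_on UNIV"
proof -
  \<comment> \<open>The midpoint of \<open>\<bar>Im w\<bar>\<close> and \<open>pi\<close> is
    positive even for real \<open>w\<close> and stays below \<open>pi\<close>, so
    \<open>sin \<beta>\<close> is positive.\<close>
  define \<beta> where "\<beta> = (\<bar>Im w\<bar> + pi) / 2"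
  have \<beta>: "\<bar>Im w\<bar> \<le> \<beta>" "0 < \<beta>" "\<beta> < pi" using w by (auto simp: \<beta>_def)
  show ?thesis
  proof (rule measurable_bounded_by_integrable_imp_absolutely_integrable)
    show "Lkernel a w \<in> borel_measurable (lebesgue_on UNIV)"
      by (intro continuous_imp_measurable_on_sets_lebesgue continuous_on_Lkernel w) auto
    show "(\<lambda>s. exp (Re w) / sin \<beta> * exp (- min a (1 - a) * \<bar>s\<bar>)) integrable_on UNIV"
      using a by (intro integrable_on_mult_right integrable_exp_minus_abs) auto
  qed (use norm_Lkernel_le[OF a \<beta>] in auto)
qed

lemma integrable_Lkernel:
  assumes "0 < a" "a < 1" "\<bar>Im w\<bar> < pi"
  shows "Lkernel a w integrable_on UNIV"
  using absolutely_integrable_Lkernel[OF assms] by (simp add: absolutely_integrable_on_def)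

lemma Lkernel_tail_le:
  assumes a: "0 < a" "a < 1" and w: "\<bar>Im w\<bar> \<le> \<beta>" "0 < \<beta>" "\<beta> < pi"
  defines "h \<equiv> \<lambda>s. exp (- min a (1 - a) * \<bar>s\<bar>)"
  shows "norm (Lstrip a w - integral {- real n..real n} (Lkernel a w))
    \<le> exp (Re w) / sin \<beta> * (integral UNIV h - integral {- real n..real n} h)"
proof -
  have "norm (Lstrip a w - integral {- real n..real n} (Lkernel a w))
    \<le> integral UNIV (\<lambda>s. exp (Re w) / sin \<beta> * h s)
      - integral {- real n..real n} (\<lambda>s. exp (Re w) / sin \<beta> * h s)"
    unfolding Lstrip_def
  proof (rule norm_integral_tail_le)
    show "Lkernel a w integrable_on UNIV"
      using w by (intro integrable_Lkernel a) auto
    show "(\<lambda>s. exp (Re w) / sin \<beta> * h s) integrable_on UNIV"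
      unfolding h_def using a by (intro integrable_on_mult_right integrable_exp_minus_abs) auto
    show "norm (Lkernel a w s) \<le> exp (Re w) / sin \<beta> * h s" for s
      unfolding h_def by (rule norm_Lkernel_le[OF a w])
  qed
  then show ?thesis
    by (simp add: algebra_simps)
qed

lemma exp_tail_tendsto_0:
  assumes "0 < a" "a < 1"
  defines "h \<equiv> \<lambda>s. exp (- min a (1 - a) * \<bar>s\<bar>)"
  shows "(\<lambda>n. integral UNIV h - integral {- real n..real n} h) \<longlonglongrightarrow> 0"
proof -
  have "(\<lambda>n. integral {- real n..real n} h) \<longlonglongrightarrow> integral UNIV h"
    unfolding h_def using assms(1,2)
    by (intro integral_symmetric_tendsto integrable_exp_minus_abs) auto
  from tendsto_diff[OF tendsto_const[of "integral UNIV h"] this] show ?thesis by simp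
qed

lemma Lstrip_limit:
  assumes a: "0 < a" "a < 1" and w: "\<bar>Im w\<bar> < pi"
  shows "(\<lambda>n. integral {- real n..real n} (Lkernel a w)) \<longlonglongrightarrow> Lstrip a w"
proof -
  define \<beta> where "\<beta> = (\<bar>Im w\<bar> + pi) / 2"
  have \<beta>: "\<bar>Im w\<bar> \<le> \<beta>" "0 < \<beta>" "\<beta> < pi" using w by (auto simp: \<beta>_def)
  have "(\<lambda>n. Lstrip a w - integral {- real n..real n} (Lkernel a w)) \<longlonglongrightarrow> 0"
  proof (rule Lim_null_comparison)
    show "\<forall>\<^sub>F n in sequentially. norm (Lstrip a w - integral {- real n..real n} (Lkernel a w))
      \<le> exp (Re w) / sin \<beta> * (integral UNIV (\<lambda>s. exp (- min a (1 - a) * \<bar>s\<bar>))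
          - integral {- real n..real n} (\<lambda>s. exp (- min a (1 - a) * \<bar>s\<bar>)))"
      using Lkernel_tail_le[OF a \<beta>] by (intro always_eventually) blast
    show "(\<lambda>n. exp (Re w) / sin \<beta> * (integral UNIV (\<lambda>s. exp (- min a (1 - a) * \<bar>s\<bar>))
          - integral {- real n..real n} (\<lambda>s. exp (- min a (1 - a) * \<bar>s\<bar>)))) \<longlonglongrightarrow> 0"
      by (rule tendsto_mult_right_zero) (rule exp_tail_tendsto_0[OF a])
  qed
  from tendsto_diff[OF tendsto_const[of "Lstrip a w"] this] show ?thesis by simp
qed

lemma open_strip: "open {w. \<bar>Im w\<bar> < c}"
  by (intro open_Collect_less continuous_intros)

lemma convex_strip: "convex {w. \<bar>Im w\<bar> < c}"
proof -
  have "{w. \<bar>Im w\<bar> < c} = {w. Im w < c} \<inter> {w. Im w > - c}" by auto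
  then show ?thesis
    by (metis convex_Int convex_halfspace_Im_gt convex_halfspace_Im_lt)
qed

section \<open>Holomorphy, and the link with the integral over the half-line\<close>

text \<open>Truncated integrals are holomorphic by differentiation under the integral sign over a
  compact interval. The tail bound makes them converge uniformly on small discs.\<close>

lemma holomorphic_Lstrip:
  assumes a: "0 < a" "a < 1"
  shows "Lstrip a holomorphic_on {w. \<bar>Im w\<bar> < pi}"
proof (rule holomorphic_uniform_sequence)
  let ?U = "{w::complex. \<bar>Im w\<bar> < pi}"
  show "open ?U" by (rule open_strip)
  show "(\<lambda>w. integral {- real n..real n} (Lkernel a w)) holomorphic_on ?U" for n
    unfolding cbox_interval[symmetric]
  proof (rule leibniz_rule_holomorphic)
    let ?D = "\<lambda>w s. exp (w + of_real (a * s)) / (1 + exp (w + of_real (a * s))) / of_real (1 + exp s)"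
    have n: "1 + exp (w + of_real (a * s)) \<notin> \<real>\<^sub>\<le>\<^sub>0" if "w \<in> ?U" for w s
      using that by (intro one_plus_exp_notin_nonpos_Reals) simp
    have e: "1 + exp s \<noteq> 0" for s :: real
      by (metis add_pos_pos exp_gt_zero less_irrefl zero_less_one)
    show "((\<lambda>w. Lkernel a w s) has_field_derivative ?D w s) (at w within ?U)" if "w \<in> ?U" for w s
      unfolding Lkernel_def using n[OF that, of s] e[of s]
      by (auto intro!: derivative_eq_intros simp: divide_inverse mult_ac simp del: of_real_add)
    show "Lkernel a w integrable_on cbox (- real n) (real n)" if "w \<in> ?U" for w
      using that by (intro integrable_continuous continuous_on_Lkernel) auto
    have n': "1 + exp (w + of_real (a * s)) \<noteq> 0" if "w \<in> ?U" for w s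
      using n[OF that, of s] by auto
    show "continuous_on (?U \<times> cbox (- real n) (real n)) (\<lambda>(w, s). ?D w s)"
      unfolding case_prod_unfold using n' e
      by (intro continuous_intros) (auto simp del: of_real_add)
  qed (rule convex_strip)
  fix x assume x: "x \<in> ?U"
  \<comment> \<open>The disc of radius \<open>d\<close> about \<open>x\<close> stays in the closed
    strip of half-width \<open>\<beta>\<close>, inside the open strip of half-width
    \<open>pi\<close>.\<close>
  define \<beta> where "\<beta> = (\<bar>Im x\<bar> + pi) / 2"
  define d where "d = \<beta> - \<bar>Im x\<bar>"
  have \<beta>: "0 < \<beta>" "\<beta> < pi" and d: "0 < d" using x by (auto simp: \<beta>_def d_def)
  have sin: "0 < sin \<beta>" using \<beta> by (intro sin_gt_zero) auto
  have I: "\<bar>Im y\<bar> \<le> \<beta>" and R: "Re y \<le> Re x + d" if "y \<in> cball x d" for y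
  proof -
    have "norm (y - x) \<le> d" using that by (simp add: dist_norm norm_minus_commute)
    then have "\<bar>Im (y - x)\<bar> \<le> d" "\<bar>Re (y - x)\<bar> \<le> d"
      by (meson abs_Im_le_cmod abs_Re_le_cmod order_trans)+
    then show "\<bar>Im y\<bar> \<le> \<beta>" "Re y \<le> Re x + d" by (auto simp: d_def)
  qed
  let ?h = "\<lambda>s. exp (- min a (1 - a) * \<bar>s\<bar>)"
  define e where "e n = integral UNIV ?h - integral {- real n..real n} ?h" for n
  define C where "C = exp (Re x + d) / sin \<beta>"
  have C: "0 < C" using sin by (simp add: C_def)
  have e0: "(\<lambda>n. C * e n) \<longlonglongrightarrow> 0"
    unfolding e_def by (rule tendsto_mult_right_zero) (rule exp_tail_tendsto_0[OF a])
  \<comment> \<open>Passing to absolute values allows \<open>exp (Re y)\<close> to be enlarged to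
    its bound on the disc without first settling the sign of \<open>e n\<close>.\<close>
  have bound: "norm (Lstrip a y - integral {- real n..real n} (Lkernel a y)) \<le> \<bar>C * e n\<bar>"
    if "y \<in> cball x d" for y n
  proof -
    have "norm (Lstrip a y - integral {- real n..real n} (Lkernel a y)) \<le> exp (Re y) / sin \<beta> * e n"
      unfolding e_def by (rule Lkernel_tail_le[OF a I[OF that] \<beta>])
    also have "\<dots> \<le> exp (Re y) / sin \<beta> * \<bar>e n\<bar>"
      using sin by (intro mult_left_mono) auto
    also have "\<dots> \<le> C * \<bar>e n\<bar>"
      unfolding C_def using sin R[OF that] by (intro mult_right_mono divide_right_mono) auto
    finally show ?thesis using C by (simp add: abs_mult)
  qed
  have "uniform_limit (cball x d) (\<lambda>n w. integral {- real n..real n} (Lkernel a w)) (Lstrip a) sequentially"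
    unfolding uniform_limit_iff
  proof (intro allI impI)
    fix \<epsilon> :: real assume "0 < \<epsilon>"
    from e0 have "\<forall>\<^sub>F n in sequentially. \<bar>C * e n\<bar> < \<epsilon>"
      using \<open>0 < \<epsilon>\<close> by (simp add: tendsto_iff)
    then show "\<forall>\<^sub>F n in sequentially. \<forall>y\<in>cball x d.
        dist (integral {- real n..real n} (Lkernel a y)) (Lstrip a y) < \<epsilon>"
    proof eventually_elim
      case (elim n)
      show ?case
      proof
        fix y assume "y \<in> cball x d"
        from bound[OF this, of n] elim
        show "dist (integral {- real n..real n} (Lkernel a y)) (Lstrip a y) < \<epsilon>"
          by (simp add: dist_norm norm_minus_commute)
      qed
    qed
  qed
  moreover have "cball x d \<subseteq> ?U" using I \<beta> by force
  ultimately show "\<exists>d>0. cball x d \<subseteq> ?U \<and>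
      uniform_limit (cball x d) (\<lambda>n w. integral {- real n..real n} (Lkernel a w)) (Lstrip a) sequentially"
    using d by blast
qed

text \<open>The Jacobian \<open>exp s\<close> cancels the factor \<open>1 / t\<close>, and at
  positive arguments the principal logarithm is the real one.\<close>

lemma Lq_integrand_exp:
  fixes a :: real
  assumes "0 < \<eta>"
  defines "f \<equiv> \<lambda>t. ln (1 + \<eta> * t powr a) / (t * (1 + t))"
  shows "of_real (exp s * f (exp s)) = Lkernel a (of_real (ln \<eta>)) s"
proof -
  have "exp s * f (exp s) = ln (1 + \<eta> * exp (a * s)) / (1 + exp s)"
    unfolding f_def by (simp add: powr_def)
  also have "\<eta> * exp (a * s) = exp (ln \<eta> + a * s)"
    using assms by (simp add: exp_add)
  finally have "exp s * f (exp s) = ln (1 + exp (ln \<eta> + a * s)) / (1 + exp s)" .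
  moreover have "of_real (ln (1 + exp (ln \<eta> + a * s))) = Ln (1 + exp (of_real (ln \<eta>) + of_real (a * s)))"
    by (subst Ln_of_real[symmetric]) (auto simp: add_pos_pos exp_of_real[symmetric])
  ultimately show ?thesis
    unfolding Lkernel_def by simp
qed

text \<open>Substitution \<open>t = exp s\<close>: absolute integrability on the half-line is
  inherited from the exponentially bounded kernel on the line, which is real for
  \<open>w = ln \<eta>\<close>.\<close>

lemma Lq_integrand_integral:
  fixes a :: real
  assumes a: "0 < a" "a < 1" and "0 < \<eta>"
  defines "f \<equiv> \<lambda>t. ln (1 + \<eta> * t powr a) / (t * (1 + t))"
  shows "f absolutely_integrable_on {0<..}"
    and "of_real (integral {0<..} f) = Lstrip a (of_real (ln \<eta>))"
proof -
  define g where "g s = exp s * f (exp s)" for s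
  have g: "(\<lambda>s. of_real (g s)) = Lkernel a (of_real (ln \<eta>))"
    unfolding g_def f_def by (rule ext) (rule Lq_integrand_exp[OF \<open>0 < \<eta>\<close>])
  have int: "(\<lambda>s. complex_of_real (g s)) absolutely_integrable_on UNIV"
    unfolding g by (rule absolutely_integrable_Lkernel[OF a]) simp
  then have "(\<lambda>s. Re (complex_of_real (g s))) absolutely_integrable_on UNIV"
    by (rule absolutely_integrable_linear[OF _ bounded_linear_Re, unfolded o_def])
  then have g': "g absolutely_integrable_on UNIV" by simp
  have "(\<lambda>x. \<bar>exp x\<bar> * f (exp x)) absolutely_integrable_on UNIV \<and>
           integral UNIV (\<lambda>x. \<bar>exp x\<bar> * f (exp x)) = integral UNIV g
     \<longleftrightarrow> f absolutely_integrable_on (exp ` UNIV) \<and> integral (exp ` UNIV) f = integral UNIV g"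
    by (rule has_absolute_integral_change_of_variables_1')
       (auto intro!: derivative_eq_intros injI)
  moreover have "exp ` UNIV = {0::real<..}"
    by (auto simp: image_iff) (metis exp_ln)
  moreover have "(\<lambda>x. \<bar>exp x\<bar> * f (exp x)) = g" by (simp add: g_def fun_eq_iff)
  ultimately have fi: "f absolutely_integrable_on {0<..}" "integral {0<..} f = integral UNIV g"
    using g' by auto
  then show "f absolutely_integrable_on {0<..}" by blast
  have "g integrable_on UNIV" using g' absolutely_integrable_on_def by blast
  then have "((\<lambda>s. complex_of_real (g s)) has_integral of_real (integral UNIV g)) UNIV"
    by (intro has_integral_of_real integrable_integral)
  then show "of_real (integral {0<..} f) = Lstrip a (of_real (ln \<eta>))"
    unfolding Lstrip_def g fi by (simp add: integral_unique)
qed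


section \<open>The difference equation\<close>

text \<open>Identity theorem with agreement on the real axis and accumulation point 0. It reduces
  each identity on a strip to real arguments.\<close>

lemma holomorphic_eq_from_Reals:
  assumes "f holomorphic_on S" "g holomorphic_on S" "open S" "connected S"
    and "\<And>x. of_real x \<in> S" "\<And>x. f (of_real x) = g (of_real x)" "w \<in> S"
  shows "f w = g w"
proof -
  have lim: "(0::complex) islimpt \<real>"
  proof (rule islimptI)
    fix T :: "complex set" assume "0 \<in> T" "open T"
    then obtain e where e: "e > 0" "ball 0 e \<subseteq> T" by (auto simp: open_contains_ball)
    then have "complex_of_real (e / 2) \<in> T" by (intro subsetD[OF e(2)]) simp
    then show "\<exists>y\<in>\<real>. y \<in> T \<and> y \<noteq> 0"
      using e by (intro bexI[of _ "complex_of_real (e / 2)"]) auto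
  qed
  have sub: "\<real> \<subseteq> S" using assms(5) by (auto elim!: Reals_cases)
  have eq: "f z - g z = 0" if "z \<in> \<real>" for z
    using that assms(6) by (metis Reals_cases right_minus_eq)
  have hol: "(\<lambda>z. f z - g z) holomorphic_on S"
    by (intro holomorphic_on_diff assms(1,2))
  have "0 \<in> S" using assms(5)[of 0] by simp
  from analytic_continuation[OF hol assms(3,4) sub this lim eq assms(7)]
  have "f w - g w = 0" .
  then show ?thesis by simp
qed

lemma contour_integral_linepath_same_Im:
  assumes "x < y"
  shows "contour_integral (linepath (of_real x + c) (of_real y + c)) f
    = integral {x..y} (\<lambda>t. f (of_real t + c))"
proof -
  have "contour_integral (linepath (of_real x + c) (of_real y + c)) f
      = contour_integral (linepath (of_real x) (of_real y)) (\<lambda>s. f (s + c))"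
    unfolding contour_integral_integral
    by (simp add: linepath_def algebra_simps scaleR_conv_of_real)
  also have "\<dots> = integral {x..y} (\<lambda>t. f (of_real t + c))"
    using assms by (subst contour_integral_linepath_Reals_eq) auto
  finally show ?thesis .
qed

text \<open>Makes the majorant of the kernel available on the vertical sides of the rectangles. The
  constant 3 comes from \<open>exp \<bar>Re s\<bar> \<ge> 2\<close>.\<close>

lemma norm_one_minus_exp_ge:
  assumes "1 \<le> \<bar>Re s\<bar>"
  shows "1 + exp (Re s) \<le> 3 * norm (1 - exp s)"
proof -
  have "1 + exp (Re s) \<le> 3 * \<bar>1 - exp (Re s)\<bar>"
  proof (cases "0 \<le> Re s")
    case True
    then have "2 \<le> exp (Re s)" using exp_ge_add_one_self[of "Re s"] assms True by linarith
    moreover from this have *: "\<bar>1 - exp (Re s)\<bar> = exp (Re s) - 1" by simp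
    ultimately show ?thesis unfolding * by simp
  next
    case False
    then have "2 \<le> exp (- Re s)" using exp_ge_add_one_self[of "- Re s"] assms False by linarith
    then have "2 * exp (Re s) \<le> 1" by (simp add: exp_minus field_simps)
    moreover from this have *: "\<bar>1 - exp (Re s)\<bar> = 1 - exp (Re s)" by simp
    ultimately show ?thesis unfolding * by simp
  qed
  also have "\<bar>1 - exp (Re s)\<bar> \<le> norm (1 - exp s)"
    using norm_triangle_ineq3[of 1 "exp s"] by simp
  finally show ?thesis by simp
qed

text \<open>Residue theorem on the rectangles with corners \<open>\<plusminus>n \<plusminus> \<pi>i\<close>, as \<open>n\<close> tends to infinity.\<close>

lemma Lstrip_difference_real:
  assumes a: "0 < a" "a < 1"
  shows "Lstrip a (of_real u + \<i> * of_real (a * pi)) - Lstrip a (of_real u - \<i> * of_real (a * pi))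
    = 2 * of_real pi * \<i> * Ln (1 + exp (of_real u))"
proof -
  \<comment> \<open>Since \<open>exp (t \<plusminus> i \<pi>) = - exp t\<close>, the values of
    \<open>F\<close> on the lines \<open>Im s = \<plusminus> \<pi>\<close> are those of the kernel
    at \<open>u \<plusminus> i a \<pi>\<close>.\<close>
  define N where "N s = Ln (1 + exp (of_real u + of_real a * s))" for s
  define F where "F s = N s / (1 - exp s)" for s
  \<comment> \<open>The bound \<open>pi / a\<close> keeps the logarithm in \<open>N\<close> off its
    cut, and \<open>2 * pi\<close> leaves 0 as the only zero of \<open>1 - exp s\<close>. As
    \<open>a < 1\<close>, \<open>c\<close> exceeds \<open>pi\<close> and the rectangles fit into
    \<open>S\<close>.\<close>
  define c where "c = min (pi / a) (2 * pi)"
  define S where "S = {s. \<bar>Im s\<bar> < c}"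
  have c: "pi < c" "c \<le> 2 * pi" "a * c \<le> pi"
    using a by (auto simp: c_def min_def field_simps)
  have S: "open S" "convex S" unfolding S_def by (rule open_strip convex_strip)+
  have aS: "\<bar>Im (of_real u + of_real a * s)\<bar> < pi" if "s \<in> S" for s
  proof -
    have "a * \<bar>Im s\<bar> < a * c"
      using that a by (intro mult_strict_left_mono) (auto simp: S_def)
    then have "a * \<bar>Im s\<bar> < pi" using c by linarith
    then show ?thesis using a by (simp add: abs_mult)
  qed
  have N: "N holomorphic_on S"
    unfolding N_def using aS
    by (intro holomorphic_intros) (use one_plus_exp_notin_nonpos_Reals in blast)
  have nz: "1 - exp s \<noteq> 0" if "s \<in> S - {0}" for s
  proof
    assume "1 - exp s = 0"
    then obtain n :: int where n: "Re s = 0" "Im s = of_int (2 * n) * pi"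
      by (metis exp_eq_1 eq_iff_diff_eq_0)
    then have "\<bar>of_int (2 * n) * pi\<bar> < 2 * pi" using that c by (simp add: S_def)
    then have "\<bar>real_of_int n\<bar> < 1" by (simp add: abs_mult)
    then have "n = 0" by linarith
    with n that show False by (auto simp: complex_eq_iff)
  qed
  have F: "F holomorphic_on S - {0}"
    unfolding F_def using nz by (intro holomorphic_intros holomorphic_on_subset[OF N]) auto
  have "0 \<in> S" using c pi_gt_zero by (simp add: S_def del: pi_gt_zero)
  have res: "residue F 0 = - Ln (1 + exp (of_real u))"
  proof -
    \<comment> \<open>A nonzero numerator makes the pole simple, so the residue is
      \<open>N 0\<close> over the derivative \<open>- 1\<close> of the denominator.\<close>
    have "N 0 \<noteq> 0"
    proof
      assume "N 0 = 0"
      moreover have "1 + exp (complex_of_real u) \<noteq> 0"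
        using one_plus_exp_notin_nonpos_Reals[of "of_real u"] by auto
      ultimately have "1 + exp (complex_of_real u) = exp 0"
        by (metis N_def add.right_neutral exp_Ln mult_zero_right)
      then show False by simp
    qed
    have "((\<lambda>s. 1 - exp s) has_field_derivative - 1) (at (0::complex))"
      by (auto intro!: derivative_eq_intros)
    then have "residue (\<lambda>s. N s / (1 - exp s)) 0 = N 0 / - 1"
      using \<open>N 0 \<noteq> 0\<close> \<open>0 \<in> S\<close> S N
      by (intro residue_simple_pole_deriv[where s = S]) (auto intro!: holomorphic_intros convex_connected)
    then show ?thesis by (simp add: F_def[abs_def] N_def)
  qed
  \<comment> \<open>Bound for \<open>F\<close> on the vertical sides at distance \<open>n\<close>:
    there the exponent in \<open>N\<close> has imaginary part at most \<open>a * pi\<close> in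
    modulus, and the quotient decays at the rate \<open>min a (1 - a)\<close>.\<close>
  define e where "e n = 3 * exp u / sin (a * pi) * exp (- min a (1 - a)) ^ n" for n
  have sin: "0 < sin (a * pi)" using a by (intro sin_gt_zero) auto
  have "e \<longlonglongrightarrow> 0"
    unfolding e_def using a by (intro tendsto_mult_right_zero LIMSEQ_power_zero) auto
  have Fle: "norm (F s) \<le> e n" if n: "\<bar>Re s\<bar> = real n" "0 < n" and s: "\<bar>Im s\<bar> \<le> pi" for s n
  proof -
    have "norm (N s) \<le> exp (Re (of_real u + of_real a * s)) / sin (a * pi)"
      unfolding N_def using a s by (intro norm_Ln_one_plus_exp_le) (auto simp: abs_mult)
    then have 1: "norm (N s) \<le> exp u * exp (a * Re s) / sin (a * pi)"
      by (simp add: exp_add)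
    have pos: "0 < 1 + exp (Re s)" by (simp add: add_pos_pos)
    have 2: "1 + exp (Re s) \<le> 3 * norm (1 - exp s)"
      using n by (intro norm_one_minus_exp_ge) auto
    with pos have "0 < norm (1 - exp s)" by linarith
    then have "norm (F s) \<le> (exp u * exp (a * Re s) / sin (a * pi)) / ((1 + exp (Re s)) / 3)"
      unfolding F_def norm_divide using 1 2 pos sin by (intro frac_le) auto
    also have "\<dots> = 3 * exp u / sin (a * pi) * (exp (a * Re s) / (1 + exp (Re s)))"
      by simp
    also have "\<dots> \<le> 3 * exp u / sin (a * pi) * exp (- min a (1 - a) * \<bar>Re s\<bar>)"
      using exp_quotient_le[OF a] sin by (intro mult_left_mono) auto
    also have "\<dots> = e n"
      unfolding e_def n by (simp add: exp_of_nat_mult[symmetric] mult_ac)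
    finally show ?thesis .
  qed
  define I where "I w n = integral {- real n..real n} (Lkernel a w)" for w n
  let ?w1 = "of_real u + \<i> * of_real (a * pi)" and ?w2 = "of_real u - \<i> * of_real (a * pi)"
  \<comment> \<open>The horizontal sides give \<open>I ?w2 n\<close> and \<open>- I ?w1 n\<close>,
    and the residue gives the logarithm. What remains are two vertical sides of length
    \<open>2 * pi\<close>.\<close>
  have main: "norm (I ?w2 n - I ?w1 n + 2 * of_real pi * \<i> * Ln (1 + exp (of_real u))) \<le> 4 * pi * e n"
    if "0 < n" for n
  proof -
    define p1 p2 p3 p4 where p: "p1 = of_real (- real n) + - \<i> * of_real pi"
      "p2 = of_real (real n) + - \<i> * of_real pi"
      "p3 = of_real (real n) + \<i> * of_real pi"
      "p4 = of_real (- real n) + \<i> * of_real pi"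
    have rp: "rectpath p1 p3 = linepath p1 p2 +++ linepath p2 p3 +++ linepath p3 p4 +++ linepath p4 p1"
      unfolding rectpath_def Let_def by (simp add: p Complex_eq)
    have in_box: "0 \<in> box p1 p3" using \<open>0 < n\<close> by (simp add: in_box_complex_iff p)
    have cbox: "cbox p1 p3 \<subseteq> S"
      using c by (auto simp: in_cbox_complex_iff p S_def)
    have le: "Re p1 \<le> Re p3" "Im p1 \<le> Im p3" by (simp_all add: p)
    have img: "path_image (rectpath p1 p3) \<subseteq> S - {0}"
      using path_image_rectpath_cbox_minus_box[OF le] cbox in_box by blast
    have wind: "winding_number (rectpath p1 p3) 0 = 1"
      using winding_number_rectpath[OF in_box] .
    have "contour_integral (rectpath p1 p3) F
        = 2 * pi * \<i> * (\<Sum>p\<in>{0}. winding_number (rectpath p1 p3) p * residue F p)"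
    proof (rule Residue_theorem[OF S(1) convex_connected[OF S(2)] _ F _ _ img])
      show "\<forall>z. z \<notin> S \<longrightarrow> winding_number (rectpath p1 p3) z = 0"
        using cbox by (intro allI impI winding_number_rectpath_outside le) auto
    qed auto
    then have total: "contour_integral (rectpath p1 p3) F = - (2 * pi * \<i> * Ln (1 + exp (of_real u)))"
      using wind res by simp
    have segs: "closed_segment p1 p2 \<union> closed_segment p2 p3 \<union> closed_segment p3 p4 \<union> closed_segment p4 p1
        \<subseteq> S - {0}"
      using img unfolding rp by (simp add: path_image_join Un_assoc)
    have int: "F contour_integrable_on linepath x y" if "closed_segment x y \<subseteq> S - {0}" for x y
      using that F by (intro contour_integrable_continuous_linepath holomorphic_on_imp_continuous_on)
        (rule holomorphic_on_subset)
    note ints = int[of p1 p2] int[of p2 p3] int[of p3 p4] int[of p4 p1]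
    have split: "contour_integral (rectpath p1 p3) F = contour_integral (linepath p1 p2) F
        + contour_integral (linepath p2 p3) F + contour_integral (linepath p3 p4) F
        + contour_integral (linepath p4 p1) F"
      using ints segs unfolding rp by (simp add: contour_integrable_join)
    have bottom: "contour_integral (linepath p1 p2) F = I ?w2 n"
      unfolding p I_def
    proof (subst contour_integral_linepath_same_Im)
      have "F (of_real t + - \<i> * of_real pi) = Lkernel a ?w2 t" for t
        unfolding F_def N_def Lkernel_def
        by (simp add: exp_add exp_diff exp_of_real algebra_simps exp_minus)
      then show "integral {- real n..real n} (\<lambda>t. F (of_real t + - \<i> * of_real pi))
          = integral {- real n..real n} (Lkernel a ?w2)" by simp
    qed (use \<open>0 < n\<close> in simp)
    have top: "contour_integral (linepath p3 p4) F = - I ?w1 n"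
    proof -
      have "contour_integral (linepath p3 p4) F = - contour_integral (linepath p4 p3) F"
        using contour_integral_reversepath[of "linepath p4 p3" F] by simp
      also have "contour_integral (linepath p4 p3) F = I ?w1 n"
        unfolding p I_def
      proof (subst contour_integral_linepath_same_Im)
        have "F (of_real t + \<i> * of_real pi) = Lkernel a ?w1 t" for t
          unfolding F_def N_def Lkernel_def
          by (simp add: exp_add exp_of_real algebra_simps)
        then show "integral {- real n..real n} (\<lambda>t. F (of_real t + \<i> * of_real pi))
            = integral {- real n..real n} (Lkernel a ?w1)" by simp
      qed (use \<open>0 < n\<close> in simp)
      finally show ?thesis .
    qed
    have side: "norm (contour_integral (linepath x y) F) \<le> e n * (2 * pi)"
      if xy: "closed_segment x y \<subseteq> S - {0}" "Re x = Re y" "\<bar>Re x\<bar> = real n"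
        "\<bar>Im x\<bar> = pi" "Im y = - Im x" for x y
    proof -
      have "norm (F s) \<le> e n" if s: "s \<in> closed_segment x y" for s
      proof (rule Fle)
        have "Re s = Re x" using s xy(2) by (auto simp: closed_segment_same_Re)
        then show "\<bar>Re s\<bar> = real n" using xy by simp
        have "Im s \<in> closed_segment (Im x) (Im y)"
          using s xy(2) by (auto simp: closed_segment_same_Re)
        then show "\<bar>Im s\<bar> \<le> pi"
          using xy by (auto simp: closed_segment_eq_real_ivl split: if_splits)
      qed fact
      moreover have "0 \<le> e n" using sin by (simp add: e_def)
      ultimately have "norm (contour_integral (linepath x y) F) \<le> e n * norm (y - x)"
        using int[OF xy(1)] by (intro contour_integral_bound_linepath) auto
      also have "norm (y - x) = 2 * pi"
      proof -
        have "y - x = \<i> * of_real (Im y - Im x)" using xy by (simp add: complex_eq_iff)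
        then have "norm (y - x) = \<bar>Im y - Im x\<bar>" by (metis norm_ii norm_mult norm_of_real mult_1)
        then show ?thesis using xy by auto
      qed
      finally show ?thesis .
    qed
    have "I ?w2 n - I ?w1 n + 2 * of_real pi * \<i> * Ln (1 + exp (of_real u))
        = - contour_integral (linepath p2 p3) F - contour_integral (linepath p4 p1) F"
      using total split bottom top by (simp add: algebra_simps)
    also have "norm \<dots> \<le> norm (contour_integral (linepath p2 p3) F)
        + norm (contour_integral (linepath p4 p1) F)"
      by (metis norm_minus_cancel norm_triangle_ineq4)
    also have "\<dots> \<le> e n * (2 * pi) + e n * (2 * pi)"
      using segs by (intro add_mono side) (auto simp: p)
    finally show ?thesis by (simp add: algebra_simps)
  qed
  have lim: "(\<lambda>n. I w n) \<longlonglongrightarrow> Lstrip a w" if "\<bar>Im w\<bar> < pi" for w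
    unfolding I_def by (rule Lstrip_limit[OF a that])
  have "(\<lambda>n. I ?w2 n - I ?w1 n + 2 * of_real pi * \<i> * Ln (1 + exp (of_real u)))
      \<longlonglongrightarrow> Lstrip a ?w2 - Lstrip a ?w1 + 2 * of_real pi * \<i> * Ln (1 + exp (of_real u))"
    using a by (intro tendsto_intros lim) (auto simp: abs_mult)
  moreover have "(\<lambda>n. I ?w2 n - I ?w1 n + 2 * of_real pi * \<i> * Ln (1 + exp (of_real u))) \<longlonglongrightarrow> 0"
  proof (rule Lim_null_comparison)
    show "\<forall>\<^sub>F n in sequentially. norm (I ?w2 n - I ?w1 n
        + 2 * of_real pi * \<i> * Ln (1 + exp (of_real u))) \<le> 4 * pi * e n"
      using eventually_gt_at_top[of 0] by eventually_elim (rule main)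
    show "(\<lambda>n. 4 * pi * e n) \<longlonglongrightarrow> 0"
      by (rule tendsto_mult_right_zero) fact
  qed
  ultimately have "Lstrip a ?w2 - Lstrip a ?w1 + 2 * of_real pi * \<i> * Ln (1 + exp (of_real u)) = 0"
    by (rule LIMSEQ_unique)
  then show ?thesis by (simp add: algebra_simps)
qed

text \<open>Both shifted arguments remain in the strip of half-width \<open>pi\<close> here, so both
  sides are holomorphic and agreement on the real axis suffices.\<close>

lemma Lstrip_difference:
  assumes a: "0 < a" "a < 1" and w: "\<bar>Im w\<bar> < pi - a * pi"
  shows "Lstrip a (w + \<i> * of_real (a * pi)) - Lstrip a (w - \<i> * of_real (a * pi))
    = 2 * of_real pi * \<i> * Ln (1 + exp w)"
proof (rule holomorphic_eq_from_Reals[where S = "{w. \<bar>Im w\<bar> < pi - a * pi}" and w = w and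
      f = "\<lambda>w. Lstrip a (w + \<i> * of_real (a * pi)) - Lstrip a (w - \<i> * of_real (a * pi))" and
      g = "\<lambda>w. 2 * of_real pi * \<i> * Ln (1 + exp w)"])
  let ?S = "{w. \<bar>Im w\<bar> < pi - a * pi}"
  have shift: "(\<lambda>w. Lstrip a (w + \<i> * of_real c)) holomorphic_on ?S" if "\<bar>c\<bar> = a * pi" for c
    using that holomorphic_on_compose_gen[OF _ holomorphic_Lstrip[OF a], of "\<lambda>w. w + \<i> * of_real c" ?S]
    by (force simp: o_def intro!: holomorphic_intros)
  show "(\<lambda>w. Lstrip a (w + \<i> * of_real (a * pi)) - Lstrip a (w - \<i> * of_real (a * pi))) holomorphic_on ?S"
    using shift[of "a * pi"] shift[of "- (a * pi)"] a by (auto intro!: holomorphic_on_diff simp: abs_mult)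
  have "0 < a * pi" using a by simp
  then show "(\<lambda>w. 2 * of_real pi * \<i> * Ln (1 + exp w)) holomorphic_on ?S"
    by (intro holomorphic_intros) (auto intro!: one_plus_exp_notin_nonpos_Reals)
  show "open ?S" "connected ?S"
    by (auto intro: open_strip convex_connected convex_strip)
  show "complex_of_real x \<in> ?S" for x using a by simp
qed (use w Lstrip_difference_real[OF a] in auto)


section \<open>Analytic continuation\<close>

definition Lq_strip :: "real \<Rightarrow> complex \<Rightarrow> complex" where
  "Lq_strip \<tau> w = (if 0 < \<tau> then 1 / (2 * pi * \<i>) else - 1 / (2 * pi * \<i>)) * Lstrip (\<bar>\<tau>\<bar> / pi) w"

lemma abs_div_pi_bounds:
  assumes "\<tau> \<noteq> 0" "\<bar>\<tau>\<bar> < pi"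
  shows "0 < \<bar>\<tau>\<bar> / pi" "\<bar>\<tau>\<bar> / pi < 1"
  using assms by simp_all

lemma Lq_integrand_altdef:
  "Lq_integrand \<tau> \<eta> = (\<lambda>t. ln (1 + \<eta> * t powr (\<bar>\<tau>\<bar> / pi)) / (t * (1 + t)))"
  by (auto simp: Lq_integrand_def fun_eq_iff)

lemma absolutely_integrable_Lq_integrand:
  assumes "\<tau> \<noteq> 0" "\<bar>\<tau>\<bar> < pi" "0 < \<eta>"
  shows "Lq_integrand \<tau> \<eta> absolutely_integrable_on {0<..}"
  unfolding Lq_integrand_altdef
  by (rule Lq_integrand_integral(1)[OF abs_div_pi_bounds[OF assms(1,2)] assms(3)])

lemma Lq_integral_eq_Lq_strip:
  assumes "\<tau> \<noteq> 0" "\<bar>\<tau>\<bar> < pi" "0 < \<eta>"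
  shows "Lq_integral \<tau> \<eta> = Lq_strip \<tau> (of_real (ln \<eta>))"
  unfolding Lq_integral_def Lq_strip_def Lq_integrand_altdef
  using Lq_integrand_integral(2)[OF abs_div_pi_bounds[OF assms(1,2)] assms(3)] by simp

lemma holomorphic_Lq_strip:
  assumes "\<tau> \<noteq> 0" "\<bar>\<tau>\<bar> < pi"
  shows "Lq_strip \<tau> holomorphic_on {w. \<bar>Im w\<bar> < pi}"
  unfolding Lq_strip_def
  by (intro holomorphic_intros holomorphic_Lstrip abs_div_pi_bounds[OF assms])

text \<open>The kernel only sees \<open>\<bar>\<tau>\<bar>\<close>. A negative \<open>\<tau>\<close>
  exchanges the two shifts, and the opposite sign of the prefactor undoes the exchange.\<close>

lemma Lq_strip_difference:
  assumes \<tau>: "\<tau> \<noteq> 0" "\<bar>\<tau>\<bar> < pi" and w: "\<bar>Im w\<bar> < pi - \<bar>\<tau>\<bar>"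
  shows "Lq_strip \<tau> (w + \<i> * of_real \<tau>) - Lq_strip \<tau> (w - \<i> * of_real \<tau>) = Ln (1 + exp w)"
proof -
  have *: "Lstrip (\<bar>\<tau>\<bar> / pi) (w + \<i> * of_real \<bar>\<tau>\<bar>) - Lstrip (\<bar>\<tau>\<bar> / pi) (w - \<i> * of_real \<bar>\<tau>\<bar>)
      = 2 * of_real pi * \<i> * Ln (1 + exp w)"
    using Lstrip_difference[OF abs_div_pi_bounds[OF \<tau>], of w] w by simp
  have "Lq_strip \<tau> (w + \<i> * of_real \<tau>) - Lq_strip \<tau> (w - \<i> * of_real \<tau>)
     = 1 / (2 * pi * \<i>) *
       (Lstrip (\<bar>\<tau>\<bar> / pi) (w + \<i> * of_real \<bar>\<tau>\<bar>) - Lstrip (\<bar>\<tau>\<bar> / pi) (w - \<i> * of_real \<bar>\<tau>\<bar>))"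
  proof (cases "0 < \<tau>")
    case True
    then show ?thesis
      by (simp add: Lq_strip_def right_diff_distrib)
  next
    case False
    then show ?thesis
      by (simp add: Lq_strip_def diff_divide_distrib)
  qed
  then show ?thesis unfolding * by simp
qed

text \<open>The two cases agree for \<open>\<bar>Im w\<bar> < \<pi>\<close>; the principal branch \<open>Ln (1 + exp w)\<close> would jump in the
  right half-plane.\<close>

definition log_one_plus_exp :: "complex \<Rightarrow> complex" where
  "log_one_plus_exp w = (if Re w \<le> 0 then Ln (1 + exp w) else w + Ln (1 + exp (- w)))"

text \<open>Factoring out \<open>exp (w / 2)\<close> leaves a number with positive real part. Both
  summands then have imaginary part below \<open>pi / 2\<close> in modulus, so their sum is the
  principal value.\<close>

lemma Ln_one_plus_exp_symmetric:
  assumes "\<bar>Im w\<bar> < pi"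
  shows "Ln (1 + exp w) = w / 2 + Ln (exp (w / 2) + exp (- w / 2))"
proof (rule Ln_unique)
  let ?c = "exp (w / 2) + exp (- w / 2)"
  have "cos (Im w / 2) > 0" using assms by (intro cos_gt_zero_pi) auto
  then have Re: "Re ?c > 0" by (simp add: Re_exp add_pos_pos)
  then have c0: "?c \<noteq> 0" by (metis less_irrefl zero_complex.sel(1))
  have c: "\<bar>Im (Ln ?c)\<bar> < pi / 2" using Re by (rule Re_Ln_pos_lt_imp)
  have "exp (w / 2 + Ln ?c) = exp (w / 2) * ?c"
    using c0 by (simp add: exp_add)
  also have "\<dots> = 1 + exp w"
    by (simp add: distrib_left mult_exp_exp)
  finally show "exp (w / 2 + Ln ?c) = 1 + exp w" .
  show "- pi < Im (w / 2 + Ln ?c)" "Im (w / 2 + Ln ?c) \<le> pi"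
    using c assms abs_less_iff[of "Im w" pi] unfolding plus_complex.sel Im_divide_numeral
    by linarith+
qed

text \<open>The second summand of the symmetric form is even in \<open>w\<close>, so the forms for
  \<open>w\<close> and \<open>- w\<close> differ by \<open>w\<close>.\<close>

lemma log_one_plus_exp_eq_Ln:
  assumes "\<bar>Im w\<bar> < pi"
  shows "log_one_plus_exp w = Ln (1 + exp w)"
  using Ln_one_plus_exp_symmetric[of w] Ln_one_plus_exp_symmetric[of "- w"] assms
  by (simp add: log_one_plus_exp_def add.commute)

text \<open>Here \<open>exp w\<close> lies in the closed unit disc, so \<open>1 + exp w\<close> can
  meet the cut only at 0. This yields continuity up to the imaginary axis from the left.\<close>

lemma one_plus_exp_notin_nonpos_Reals_left:
  assumes "Re w \<le> 0" "exp w \<noteq> - 1"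
  shows "1 + exp w \<notin> \<real>\<^sub>\<le>\<^sub>0"
proof
  assume *: "1 + exp w \<in> \<real>\<^sub>\<le>\<^sub>0"
  then have "Re (exp w) \<le> - 1" "Im (exp w) = 0" by (auto simp: complex_nonpos_Reals_iff)
  moreover have "\<bar>Re (exp w)\<bar> \<le> 1"
    using abs_Re_le_cmod[of "exp w"] assms(1) by (simp add: order_trans)
  ultimately have "exp w = - 1" by (auto simp: complex_eq_iff)
  with assms show False by simp
qed

lemma continuous_on_log_one_plus_exp:
  "continuous_on {w. Re w \<le> 0 \<and> exp w \<noteq> - 1} log_one_plus_exp"
proof -
  have "continuous_on {w. Re w \<le> 0 \<and> exp w \<noteq> - 1} (\<lambda>w. Ln (1 + exp w))"
    by (intro continuous_intros) (use one_plus_exp_notin_nonpos_Reals_left in auto)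
  then show ?thesis
    by (rule continuous_on_eq) (simp add: log_one_plus_exp_def)
qed

lemma holomorphic_log_one_plus_exp:
  "log_one_plus_exp holomorphic_on {w. Re w \<noteq> 0 \<or> \<bar>Im w\<bar> < pi}"
proof -
  have left: "1 + exp w \<notin> \<real>\<^sub>\<le>\<^sub>0" if "Re w < 0" for w
  proof (rule one_plus_exp_notin_nonpos_Reals_left)
    have "norm (exp w) < 1" using that by simp
    then show "exp w \<noteq> - 1" by (metis less_irrefl norm_minus_cancel norm_one)
  qed (use that in simp)
  have "(\<lambda>w. Ln (1 + exp w)) holomorphic_on {w. Re w < 0}"
    using left by (intro holomorphic_intros) auto
  then have 1: "log_one_plus_exp holomorphic_on {w. Re w < 0}"
    by (rule holomorphic_transform) (simp add: log_one_plus_exp_def)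
  have "(\<lambda>w. w + Ln (1 + exp (- w))) holomorphic_on {w. Re w > 0}"
    using left by (intro holomorphic_intros) auto
  then have 2: "log_one_plus_exp holomorphic_on {w. Re w > 0}"
    by (rule holomorphic_transform) (simp add: log_one_plus_exp_def)
  have "(\<lambda>w. Ln (1 + exp w)) holomorphic_on {w. \<bar>Im w\<bar> < pi}"
    using one_plus_exp_notin_nonpos_Reals by (intro holomorphic_intros) auto
  then have 3: "log_one_plus_exp holomorphic_on {w. \<bar>Im w\<bar> < pi}"
    by (rule holomorphic_transform) (simp add: log_one_plus_exp_eq_Ln)
  have "log_one_plus_exp holomorphic_on ({w. Re w < 0} \<union> {w. Re w > 0} \<union> {w. \<bar>Im w\<bar> < pi})"
    by (intro holomorphic_on_Un 1 2 3 open_strip open_Un open_halfspace_Re_lt open_halfspace_Re_gt)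
  moreover have "{w. Re w < 0} \<union> {w. Re w > 0} \<union> {w. \<bar>Im w\<bar> < pi} = {w. Re w \<noteq> 0 \<or> \<bar>Im w\<bar> < pi}"
    by auto
  ultimately show ?thesis by simp
qed

text \<open>\<open>Lq_shift \<tau> k\<close> iterates the difference equation \<open>k\<close> times. It is used where
  \<open>\<bar>Im w - 2k\<tau>\<bar> < \<pi>\<close>; different admissible \<open>k\<close> give the same value, and rounding
  \<open>Im w / (2\<tau>)\<close> selects one of them.\<close>

definition shift_node :: "real \<Rightarrow> complex \<Rightarrow> int \<Rightarrow> complex" where
  "shift_node \<tau> w j = w - \<i> * of_real (\<tau> * (2 * of_int j + 1))"

definition Lq_shift :: "real \<Rightarrow> int \<Rightarrow> complex \<Rightarrow> complex" where
  "Lq_shift \<tau> k w = Lq_strip \<tau> (w - \<i> * of_real (2 * \<tau> * of_int k))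
     + (\<Sum>j\<in>{0..<k}. log_one_plus_exp (shift_node \<tau> w j))
     - (\<Sum>j\<in>{k..<0}. log_one_plus_exp (shift_node \<tau> w j))"

definition Lq_cont :: "real \<Rightarrow> complex \<Rightarrow> complex" where
  "Lq_cont \<tau> w = Lq_shift \<tau> (round (Im w / (2 * \<tau>))) w"

section \<open>Independence of the number of shifts\<close>

text \<open>The node with index \<open>k\<close> is the midpoint of the two arguments of
  \<open>Lq_strip\<close>, and as both lie in the strip, the difference equation holds there. Its
  term joins the first sum for \<open>k \<ge> 0\<close> and leaves the second for
  \<open>k < 0\<close>.\<close>

lemma Lq_shift_Suc:
  assumes \<tau>: "\<tau> \<noteq> 0" "\<bar>\<tau>\<bar> < pi"
    and "\<bar>Im w - 2 * \<tau> * of_int k\<bar> < pi" "\<bar>Im w - 2 * \<tau> * of_int (k + 1)\<bar> < pi"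
  shows "Lq_shift \<tau> (k + 1) w = Lq_shift \<tau> k w"
proof -
  let ?u = "shift_node \<tau> w k"
  have Im: "\<bar>Im ?u\<bar> < pi - \<bar>\<tau>\<bar>"
    using assms(3,4) by (auto simp: shift_node_def abs_if algebra_simps split: if_splits)
  have u: "?u + \<i> * of_real \<tau> = w - \<i> * of_real (2 * \<tau> * of_int k)"
    "?u - \<i> * of_real \<tau> = w - \<i> * of_real (2 * \<tau> * of_int (k + 1))"
    by (simp_all add: shift_node_def algebra_simps)
  have step: "Lq_strip \<tau> (w - \<i> * of_real (2 * \<tau> * of_int k))
      - Lq_strip \<tau> (w - \<i> * of_real (2 * \<tau> * of_int (k + 1))) = log_one_plus_exp ?u"
    using Lq_strip_difference[OF \<tau> Im] log_one_plus_exp_eq_Ln[of ?u] Im unfolding u by simp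
  show ?thesis
  proof (cases "0 \<le> k")
    case True
    then have "{0..<k + 1} = insert k {0..<k}" "{k..<0} = {}" "{k + 1..<0} = {}" by auto
    then show ?thesis using step unfolding Lq_shift_def by (simp add: algebra_simps)
  next
    case False
    then have "{k..<0} = insert k {k + 1..<0}" "{0..<k} = {}" "{0..<k + 1} = {}" by auto
    then show ?thesis using step unfolding Lq_shift_def by (simp add: algebra_simps)
  qed
qed

text \<open>\<open>Im w - 2 * \<tau> * k\<close> is monotone in \<open>k\<close>, so all indices
  between two admissible ones are admissible and the induction never leaves them.\<close>

lemma Lq_shift_le_eq:
  assumes \<tau>: "\<tau> \<noteq> 0" "\<bar>\<tau>\<bar> < pi" and "k \<le> l"
    and k: "\<bar>Im w - 2 * \<tau> * of_int k\<bar> < pi" and l: "\<bar>Im w - 2 * \<tau> * of_int l\<bar> < pi"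
  shows "Lq_shift \<tau> k w = Lq_shift \<tau> l w"
  using \<open>k \<le> l\<close> l
proof (induction l rule: int_ge_induct)
  case (step l)
  have "\<bar>Im w - 2 * \<tau> * of_int l\<bar> < pi"
  proof (cases "0 < \<tau>")
    case True
    then have "\<tau> * of_int k \<le> \<tau> * of_int l" using step by (intro mult_left_mono) auto
    moreover have "\<tau> * of_int l \<le> \<tau> * of_int (l + 1)" using True by (intro mult_left_mono) auto
    ultimately show ?thesis using k step.prems by (simp add: abs_less_iff)
  next
    case False
    then have "\<tau> * of_int l \<le> \<tau> * of_int k" using step by (intro mult_left_mono_neg) auto
    moreover have "\<tau> * of_int (l + 1) \<le> \<tau> * of_int l" using False by (intro mult_left_mono_neg) auto
    ultimately show ?thesis using k step.prems by (simp add: abs_less_iff)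
  qed
  then show ?case using step Lq_shift_Suc[OF \<tau>, of w l] by simp
qed simp

text \<open>A rounding error of at most one half becomes at most \<open>\<bar>\<tau>\<bar>\<close>
  after scaling, so an admissible index always exists.\<close>

lemma strip_index_bound:
  assumes "\<tau> \<noteq> 0" "\<bar>\<tau>\<bar> < pi"
  shows "\<bar>y - 2 * \<tau> * of_int (round (y / (2 * \<tau>)))\<bar> < pi"
proof -
  define l where "l = round (y / (2 * \<tau>))"
  have "\<bar>of_int l - y / (2 * \<tau>)\<bar> \<le> 1 / 2"
    unfolding l_def by (rule of_int_round_abs_le)
  then have "\<bar>2 * \<tau>\<bar> * \<bar>of_int l - y / (2 * \<tau>)\<bar> \<le> \<bar>2 * \<tau>\<bar> * (1 / 2)"
    by (intro mult_left_mono) auto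
  also have "\<bar>2 * \<tau>\<bar> * \<bar>of_int l - y / (2 * \<tau>)\<bar> = \<bar>2 * \<tau> * of_int l - y\<bar>"
    unfolding abs_mult[symmetric] using assms by (simp add: right_diff_distrib)
  finally show ?thesis unfolding l_def[symmetric] using assms by linarith
qed

lemma Lq_cont_eq_shift:
  assumes \<tau>: "\<tau> \<noteq> 0" "\<bar>\<tau>\<bar> < pi" and k: "\<bar>Im w - 2 * \<tau> * of_int k\<bar> < pi"
  shows "Lq_cont \<tau> w = Lq_shift \<tau> k w"
proof -
  note l = strip_index_bound[OF \<tau>, of "Im w"]
  with k show ?thesis
    unfolding Lq_cont_def using l
    by (cases "k \<le> round (Im w / (2 * \<tau>))") (auto intro: Lq_shift_le_eq[OF \<tau>] Lq_shift_le_eq[OF \<tau>, symmetric])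
qed

lemma Lq_cont_strip:
  assumes "\<tau> \<noteq> 0" "\<bar>\<tau>\<bar> < pi" "\<bar>Im w\<bar> < pi"
  shows "Lq_cont \<tau> w = Lq_strip \<tau> w"
  using Lq_cont_eq_shift[of \<tau> w 0] assms by (simp add: Lq_shift_def)

text \<open>The nodes are equally spaced: the bound on \<open>Im w\<close> controls one end,
  admissibility of \<open>k\<close> the other. This keeps the logarithms holomorphic on the axis up
  to the tips of the cuts.\<close>

lemma shift_node_bound:
  assumes "\<bar>Im w\<bar> < pi + \<bar>\<tau>\<bar>" "\<bar>Im w - 2 * \<tau> * of_int k\<bar> < pi"
    and j: "j \<in> {0..<k} \<union> {k..<0}"
  shows "\<bar>Im (shift_node \<tau> w j)\<bar> < pi"
proof -
  \<comment> \<open>Treats a nonnegative step; negative \<open>\<tau>\<close> follows by changing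
    the signs of \<open>\<tau>\<close> and \<open>Im w\<close> together.\<close>
  have *: "\<bar>y - t * (2 * of_int j + 1)\<bar> < pi"
    if t: "0 \<le> t" "\<bar>y\<bar> < pi + t" "\<bar>y - 2 * t * of_int k\<bar> < pi" for t y :: real
  proof -
    consider "0 \<le> j" "j + 1 \<le> k" | "k \<le> j" "j + 1 \<le> 0" using j by auto
    then show ?thesis
    proof cases
      case 1
      have "0 \<le> t * real_of_int j" using 1 t by simp
      moreover have "t * real_of_int (j + 1) \<le> t * of_int k"
        using 1 t by (intro mult_left_mono) (simp_all only: of_int_le_iff)
      ultimately show ?thesis using t by (simp add: abs_less_iff algebra_simps)
    next
      case 2
      have "t * real_of_int (j + 1) \<le> t * of_int 0"
        using 2 t by (intro mult_left_mono) (simp_all only: of_int_le_iff)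
      moreover have "t * real_of_int k \<le> t * of_int j"
        using 2 t by (intro mult_left_mono) (simp_all only: of_int_le_iff)
      ultimately show ?thesis using t by (simp add: abs_less_iff algebra_simps)
    qed
  qed
  show ?thesis
  proof (cases "0 \<le> \<tau>")
    case True
    then show ?thesis using *[of \<tau> "Im w"] assms by (simp add: shift_node_def)
  next
    case False
    then have "\<bar>- Im w - (- \<tau>) * (2 * of_int j + 1)\<bar> < pi"
      using assms by (intro *) (auto simp: abs_less_iff)
    then show ?thesis by (simp add: shift_node_def abs_less_iff)
  qed
qed

section \<open>Regularity of the continuation\<close>

text \<open>On each open set \<open>V k\<close> the index can be frozen at \<open>k\<close>, so the
  jumps of the rounding do not matter; these sets cover the domain.\<close>

lemma holomorphic_Lq_cont:
  assumes \<tau>: "\<tau> \<noteq> 0" "\<bar>\<tau>\<bar> < pi"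
  shows "Lq_cont \<tau> holomorphic_on {w. Re w \<noteq> 0 \<or> \<bar>Im w\<bar> < pi + \<bar>\<tau>\<bar>}"
proof -
  let ?D = "{w. Re w \<noteq> 0 \<or> \<bar>Im w\<bar> < pi + \<bar>\<tau>\<bar>}"
  define V where "V k = ?D \<inter> {w. \<bar>Im w - 2 * \<tau> * of_int k\<bar> < pi}" for k :: int
  have "open (V k)" for k
    unfolding V_def
    by (intro open_Int open_Collect_disj open_Collect_less open_Collect_neq continuous_intros)
  moreover have "Lq_cont \<tau> holomorphic_on V k" for k
  proof -
    have "(\<lambda>w. log_one_plus_exp (shift_node \<tau> w j)) holomorphic_on V k"
      if "j \<in> {0..<k} \<union> {k..<0}" for j
    proof (rule holomorphic_on_compose_gen[OF _ holomorphic_log_one_plus_exp, unfolded o_def])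
      show "(\<lambda>w. shift_node \<tau> w j) holomorphic_on V k"
        unfolding shift_node_def by (intro holomorphic_intros)
      show "(\<lambda>w. shift_node \<tau> w j) ` V k \<subseteq> {w. Re w \<noteq> 0 \<or> \<bar>Im w\<bar> < pi}"
        using shift_node_bound[OF _ _ that] by (auto simp: V_def) (auto simp: shift_node_def)
    qed
    moreover have "(\<lambda>w. Lq_strip \<tau> (w - \<i> * of_real (2 * \<tau> * of_int k))) holomorphic_on V k"
      by (rule holomorphic_on_compose_gen[OF _ holomorphic_Lq_strip[OF \<tau>], unfolded o_def])
         (auto intro!: holomorphic_intros simp: V_def)
    ultimately have "Lq_shift \<tau> k holomorphic_on V k"
      unfolding Lq_shift_def by (intro holomorphic_intros) auto
    then show ?thesis
      by (rule holomorphic_transform) (auto simp: V_def Lq_cont_eq_shift[OF \<tau>])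
  qed
  moreover have "?D = (\<Union>k. V k)"
    using strip_index_bound[OF \<tau>] by (auto simp: V_def)
  ultimately show ?thesis
    using holomorphic_on_UN_open[of UNIV "Lq_cont \<tau>" V] by simp
qed

text \<open>With the index frozen near \<open>w\<close>, a node has exponential \<open>- 1\<close>
  only if \<open>exp w = - exp (i \<tau> n)\<close> with \<open>n = 2 j + 1\<close> odd. Exactly
  such values are excluded.\<close>

lemma continuous_on_Lq_cont:
  assumes \<tau>: "\<tau> \<noteq> 0" "\<bar>\<tau>\<bar> < pi"
  shows "continuous_on {w. Re w \<le> 0 \<and> (\<forall>n::int. odd n \<longrightarrow> exp w \<noteq> - exp (\<i> * of_real (\<tau> * of_int n)))}
    (Lq_cont \<tau>)"
    (is "continuous_on ?C _")
  unfolding continuous_on_eq_continuous_within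
proof
  fix w assume w: "w \<in> ?C"
  obtain k :: int where k: "\<bar>Im w - 2 * \<tau> * of_int k\<bar> < pi"
    using strip_index_bound[OF \<tau>] by blast
  define V where "V = {w. \<bar>Im w - 2 * \<tau> * of_int k\<bar> < pi}"
  have V: "open V" "w \<in> V"
    unfolding V_def using k by (auto intro!: open_Collect_less continuous_intros)
  have "continuous_on (?C \<inter> V) (\<lambda>w. log_one_plus_exp (shift_node \<tau> w j))" for j
  proof (rule continuous_on_compose2[OF continuous_on_log_one_plus_exp])
    show "continuous_on (?C \<inter> V) (\<lambda>w. shift_node \<tau> w j)"
      unfolding shift_node_def by (intro continuous_intros)
    show "(\<lambda>w. shift_node \<tau> w j) ` (?C \<inter> V) \<subseteq> {w. Re w \<le> 0 \<and> exp w \<noteq> - 1}"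
    proof clarify
      fix v assume v: "Re v \<le> 0" "\<forall>n::int. odd n \<longrightarrow> exp v \<noteq> - exp (\<i> * of_real (\<tau> * of_int n))"
      have "exp v = exp (shift_node \<tau> v j) * exp (\<i> * of_real (\<tau> * of_int (2 * j + 1)))"
        by (simp add: shift_node_def exp_add[symmetric])
      moreover have "exp v \<noteq> - exp (\<i> * of_real (\<tau> * of_int (2 * j + 1)))"
        using v(2) by (rule allE[of _ "2 * j + 1"]) auto
      ultimately have "exp (shift_node \<tau> v j) \<noteq> - 1" by auto
      then show "Re (shift_node \<tau> v j) \<le> 0 \<and> exp (shift_node \<tau> v j) \<noteq> - 1"
        using v(1) by (simp add: shift_node_def)
    qed
  qed
  moreover have "continuous_on (?C \<inter> V) (\<lambda>w. Lq_strip \<tau> (w - \<i> * of_real (2 * \<tau> * of_int k)))"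
    by (rule continuous_on_compose2[OF holomorphic_on_imp_continuous_on[OF holomorphic_Lq_strip[OF \<tau>]]])
       (auto intro!: continuous_intros simp: V_def)
  ultimately have "continuous_on (?C \<inter> V) (Lq_shift \<tau> k)"
    unfolding Lq_shift_def by (intro continuous_intros)
  then have "continuous_on (?C \<inter> V) (Lq_cont \<tau>)"
    by (rule continuous_on_eq) (auto simp: V_def Lq_cont_eq_shift[OF \<tau>])
  then have "continuous (at w within (?C \<inter> V)) (Lq_cont \<tau>)"
    using w V by (simp add: continuous_on_eq_continuous_within)
  moreover have "at w within (?C \<inter> V) = at w within ?C"
    using V by (intro at_within_nhd[of w V]) auto
  ultimately show "continuous (at w within ?C) (Lq_cont \<tau>)" by simp
qed


section \<open>Arbitrary continuations\<close>

text \<open>The first and second powers in \<open>generic_unit\<close> rule out \<open>q = 1\<close>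
  and \<open>q = - 1\<close>, which puts \<open>\<bar>Arg q\<bar> / pi\<close> strictly between 0
  and 1.\<close>

lemma generic_unit_Arg:
  assumes "generic_unit q"
  shows "Arg q \<noteq> 0" "\<bar>Arg q\<bar> < pi" "q = exp (\<i> * of_real (Arg q))"
proof -
  have q: "norm q = 1" "q \<noteq> 0" and g: "\<And>n::nat. 0 < n \<Longrightarrow> q ^ n \<noteq> 1"
    using assms by (auto simp: generic_unit_def)
  show *: "q = exp (\<i> * of_real (Arg q))"
    using q by (metis Arg_eq mult_1 of_real_1)
  show "Arg q \<noteq> 0" using g[of 1] * by auto
  have "Arg q \<noteq> pi"
  proof
    assume "Arg q = pi"
    with * have "q = - 1" by simp
    with g[of 2] show False by simp
  qed
  then show "\<bar>Arg q\<bar> < pi" using Arg_bounded[of q] by auto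
qed

lemma generic_unit_powi:
  assumes "generic_unit q"
  shows "q powi n = exp (\<i> * of_real (Arg q * of_int n))"
proof -
  have "q powi n = exp (\<i> * of_real (Arg q)) powi n"
    using generic_unit_Arg(3)[OF assms] by simp
  also have "\<dots> = exp (\<i> * of_real (Arg q * of_int n))"
    by (simp add: exp_power_int mult_ac)
  finally show ?thesis .
qed

lemma generic_unit_powr:
  assumes "generic_unit q"
  shows "q powr of_real x = exp (\<i> * of_real (Arg q * x))"
proof -
  have "q \<noteq> 0" "norm q = 1" using assms by (auto simp: generic_unit_def)
  then have "Ln q = \<i> * of_real (Arg q)"
    by (simp add: Ln_Arg)
  with \<open>q \<noteq> 0\<close> show ?thesis by (simp add: powr_def mult_ac)
qed

text \<open>Existence of a continuation, which keeps the assertion about every such \<open>L\<close>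
  from being vacuous.\<close>

lemma is_Lq_Lq_cont:
  assumes "generic_unit q"
  shows "is_Lq q (Lq_cont (Arg q))"
  unfolding is_Lq_def
proof (intro conjI allI impI)
  note \<tau> = generic_unit_Arg(1,2)[OF assms]
  show "Lq_cont (Arg q) (of_real (ln \<eta>)) = Lq_integral (Arg q) \<eta>" if "0 < \<eta>" for \<eta>
    using Lq_integral_eq_Lq_strip[OF \<tau> that] Lq_cont_strip[OF \<tau>, of "of_real (ln \<eta>)"] by simp
  show "Lq_cont (Arg q) holomorphic_on {w. Re w \<noteq> 0 \<or> \<bar>Im w\<bar> < pi + \<bar>Arg q\<bar>}"
    by (rule holomorphic_Lq_cont[OF \<tau>])
  show "continuous_on {w. Re w \<le> 0 \<and> (\<forall>n::int. odd n \<longrightarrow> exp w \<noteq> - (q powi n))} (Lq_cont (Arg q))"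
    unfolding generic_unit_powi[OF assms] by (rule continuous_on_Lq_cont[OF \<tau>])
qed

text \<open>The values prescribed at \<open>ln \<eta>\<close> for positive \<open>\<eta>\<close>
  fill the real axis, so the identity theorem determines \<open>L\<close> on the strip.\<close>

lemma is_Lq_eq_Lq_strip:
  assumes "generic_unit q" "is_Lq q L" "\<bar>Im w\<bar> < pi"
  shows "L w = Lq_strip (Arg q) w"
proof (rule holomorphic_eq_from_Reals[where S = "{w. \<bar>Im w\<bar> < pi}" and w = w and
      f = L and g = "Lq_strip (Arg q)"])
  note \<tau> = generic_unit_Arg(1,2)[OF assms(1)]
  show "L holomorphic_on {w. \<bar>Im w\<bar> < pi}"
    using assms(2) unfolding is_Lq_def by (auto elim: holomorphic_on_subset)
  show "Lq_strip (Arg q) holomorphic_on {w. \<bar>Im w\<bar> < pi}"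
    by (rule holomorphic_Lq_strip[OF \<tau>])
  show "open {w. \<bar>Im w\<bar> < pi}" "connected {w. \<bar>Im w\<bar> < pi}"
    by (auto intro: open_strip convex_connected convex_strip)
  show "L (of_real x) = Lq_strip (Arg q) (of_real x)" for x
  proof -
    have "L (of_real (ln (exp x))) = Lq_integral (Arg q) (exp x)"
      using assms(2) unfolding is_Lq_def by (meson exp_gt_zero)
    then show ?thesis using Lq_integral_eq_Lq_strip[OF \<tau>, of "exp x"] by simp
  qed
qed (use assms in auto)

lemma holomorphic_shift_difference:
  assumes "L holomorphic_on D" "\<And>w. w \<in> A \<Longrightarrow> w + c \<in> D" "\<And>w. w \<in> A \<Longrightarrow> w - c \<in> D"
  shows "(\<lambda>w. L (w + c) - L (w - c)) holomorphic_on A"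
proof (rule holomorphic_on_diff)
  show "(\<lambda>w. L (w + c)) holomorphic_on A"
    using assms by (intro holomorphic_on_compose_gen[OF _ assms(1), unfolded o_def] holomorphic_intros) auto
  show "(\<lambda>w. L (w - c)) holomorphic_on A"
    using assms by (intro holomorphic_on_compose_gen[OF _ assms(1), unfolded o_def] holomorphic_intros) auto
qed

text \<open>\<open>L\<close> is holomorphic up to height \<open>pi + \<bar>Arg q\<bar>\<close>, so
  the identity known for the integral near the real axis extends to the full strip of half-width
  \<open>pi\<close>.\<close>

lemma is_Lq_difference:
  assumes g: "generic_unit q" and L: "is_Lq q L" and w: "\<bar>Im w\<bar> < pi"
  shows "L (w + \<i> * of_real (Arg q)) - L (w - \<i> * of_real (Arg q)) = Ln (1 + exp w)"
proof (rule holomorphic_eq_from_Reals[where S = "{w. \<bar>Im w\<bar> < pi}" and w = w and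
      f = "\<lambda>w. L (w + \<i> * of_real (Arg q)) - L (w - \<i> * of_real (Arg q))" and
      g = "\<lambda>w. Ln (1 + exp w)"])
  note \<tau> = generic_unit_Arg(1,2)[OF g]
  have hol: "L holomorphic_on {w. Re w \<noteq> 0 \<or> \<bar>Im w\<bar> < pi + \<bar>Arg q\<bar>}"
    using L by (simp add: is_Lq_def)
  show "(\<lambda>w. L (w + \<i> * of_real (Arg q)) - L (w - \<i> * of_real (Arg q)))
      holomorphic_on {w. \<bar>Im w\<bar> < pi}"
    by (rule holomorphic_shift_difference[OF hol]) auto
  show "(\<lambda>w. Ln (1 + exp w)) holomorphic_on {w. \<bar>Im w\<bar> < pi}"
    using one_plus_exp_notin_nonpos_Reals by (intro holomorphic_intros) auto
  show "open {w. \<bar>Im w\<bar> < pi}" "connected {w. \<bar>Im w\<bar> < pi}"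
    by (auto intro: open_strip convex_connected convex_strip)
  show "L (of_real x + \<i> * of_real (Arg q)) - L (of_real x - \<i> * of_real (Arg q))
      = Ln (1 + exp (of_real x))" for x
    using \<tau> by (simp add: is_Lq_eq_Lq_strip[OF g L] Lq_strip_difference[OF \<tau>])
qed (use w in auto)

text \<open>Exponentiation removes the ambiguity by multiples of \<open>2 \<pi> i\<close>: the right
  side becomes entire and the equation extends beyond the strip. The excluded \<open>w\<close> are
  those for which the shifted arguments satisfy \<open>exp = - q powi n\<close> with
  \<open>n\<close> odd.\<close>

lemma exp_is_Lq_difference:
  assumes g: "generic_unit q" and L: "is_Lq q L"
    and w: "\<And>n::int. exp w \<noteq> - (q powi (2 * n))"
  shows "exp (L (w + \<i> * of_real (Arg q)) - L (w - \<i> * of_real (Arg q))) = 1 + exp w"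
proof -
  let ?c = "\<i> * of_real (Arg q)"
  define D where "D w = L (w + ?c) - L (w - ?c)" for w
  let ?hol = "{w. Re w \<noteq> 0 \<or> \<bar>Im w\<bar> < pi + \<bar>Arg q\<bar>}"
  let ?cont = "{w. Re w \<le> 0 \<and> (\<forall>n::int. odd n \<longrightarrow> exp w \<noteq> - (q powi n))}"
  have hol: "L holomorphic_on ?hol" and cont: "continuous_on ?cont L"
    using L by (simp_all add: is_Lq_def)
  have strip: "exp (D v) = 1 + exp v" if "\<bar>Im v\<bar> < pi" for v
    unfolding D_def is_Lq_difference[OF g L that]
    using one_plus_exp_notin_nonpos_Reals[OF that] by (intro exp_Ln) auto
  \<comment> \<open>\<open>H\<close> will be an open half-plane; the point \<open>x\<close> shows
    that it meets the strip, where the equation is known.\<close>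
  have half: "exp (D v) = 1 + exp v"
    if "v \<in> H" "open H" "convex H" "x \<in> H" "\<bar>Im x\<bar> < pi" "\<And>w. w \<in> H \<Longrightarrow> Re w \<noteq> 0"
    for v x H
  proof (rule analytic_continuation_open[where s = "H \<inter> {w. \<bar>Im w\<bar> < pi}" and s' = H and z = v and
        f = "\<lambda>v. exp (D v)" and g = "\<lambda>v. 1 + exp v"])
    show "(\<lambda>v. exp (D v)) holomorphic_on H"
      unfolding D_def using that(6)
      by (intro holomorphic_on_exp' holomorphic_shift_difference[OF hol]) auto
  qed (use that strip in \<open>auto intro!: holomorphic_intros open_Int open_strip convex_connected\<close>)
  have off_axis: "exp (D v) = 1 + exp v" if "Re v \<noteq> 0" for v
  proof (cases "0 < Re v")
    case True
    then show ?thesis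
      by (intro half[of _ "{w. Re w > 0}" 1])
         (auto intro!: open_halfspace_Re_gt convex_halfspace_Re_gt)
  next
    case False
    with that show ?thesis
      by (intro half[of _ "{w. Re w < 0}" "- 1"])
         (auto intro!: open_halfspace_Re_lt convex_halfspace_Re_lt)
  qed
  show ?thesis
  proof (cases "Re w = 0")
    case False
    then show ?thesis using off_axis by (simp add: D_def)
  next
    case True
    have e: "exp ?c = q powi 1" "exp (- ?c) = q powi (- 1)"
      using generic_unit_powi[OF g, of 1] generic_unit_powi[OF g, of "- 1"] by simp_all
    have q0: "q \<noteq> 0" using g by (auto simp: generic_unit_def)
    \<comment> \<open>Shifting by \<open>\<plusminus> i Arg q\<close> changes the exponent of
      \<open>q\<close> by one, so the exclusion of even exponents at \<open>w\<close> excludes odd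
      ones at the shifted points.\<close>
    have mem: "w + of_int s * ?c \<in> ?cont" if "s = 1 \<or> s = - 1" for s :: int
    proof -
      have "exp (w + of_int s * ?c) \<noteq> - (q powi n)" if "odd n" for n
      proof
        assume *: "exp (w + of_int s * ?c) = - (q powi n)"
        have "exp w = exp (w + of_int s * ?c) * exp (- (of_int s * ?c))"
          by (simp add: exp_add[symmetric])
        also have "exp (- (of_int s * ?c)) = q powi (- s)"
          using \<open>s = 1 \<or> s = - 1\<close> e by auto
        also have "exp (w + of_int s * ?c) * q powi (- s) = - (q powi (n - s))"
          unfolding * using q0 by (simp add: power_int_add[symmetric])
        finally have "exp w = - (q powi (n - s))" .
        moreover have "even (n - s)"
          using \<open>odd n\<close> \<open>s = 1 \<or> s = - 1\<close> by auto
        then obtain m where "n - s = 2 * m" by (rule evenE)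
        ultimately show False using w[of m] by simp
      qed
      with True show ?thesis by simp
    qed
    \<comment> \<open>The approach is from the left, where \<open>is_Lq\<close> gives continuity up
      to the axis. Points with negative real part have \<open>norm (exp v) < 1\<close> and thus
      avoid the excluded unimodular values.\<close>
    define X where "X n = - complex_of_real (inverse (real (Suc n)))" for n
    have "X \<longlonglongrightarrow> - complex_of_real 0"
      unfolding X_def by (intro tendsto_minus tendsto_of_real LIMSEQ_inverse_real_of_nat)
    then have X: "X \<longlonglongrightarrow> 0" by simp
    have memX: "v + X n \<in> ?cont" if "Re v = 0" for v n
    proof -
      have "norm (exp (v + X n)) < 1" using that by (simp add: X_def)
      moreover have "norm (- (q powi m)) = 1" for m
        using g by (simp add: norm_power_int generic_unit_def)
      ultimately have "exp (v + X n) \<noteq> - (q powi m)" for m by (metis less_irrefl)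
      then show ?thesis using that by (simp add: X_def)
    qed
    have lim: "(\<lambda>n. L (w + of_int s * ?c + X n)) \<longlonglongrightarrow> L (w + of_int s * ?c)" if "s = 1 \<or> s = - 1" for s :: int
    proof (rule continuous_on_tendsto_compose[OF cont])
      show "(\<lambda>n. w + of_int s * ?c + X n) \<longlonglongrightarrow> w + of_int s * ?c"
        using tendsto_add[OF tendsto_const X] by simp
      show "\<forall>\<^sub>F n in sequentially. w + of_int s * ?c + X n \<in> ?cont"
        using True by (intro always_eventually allI memX) simp
    qed (rule mem[OF that])
    have "(\<lambda>n. D (w + X n)) \<longlonglongrightarrow> D w"
      using tendsto_diff[OF lim[of 1] lim[of "- 1"]] by (simp add: D_def algebra_simps)
    then have "(\<lambda>n. exp (D (w + X n))) \<longlonglongrightarrow> exp (D w)" by (rule tendsto_exp)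
    moreover have "(\<lambda>n. exp (D (w + X n))) = (\<lambda>n. 1 + exp (w + X n))"
      using True by (intro ext off_axis) (simp add: X_def)
    moreover have "(\<lambda>n. 1 + exp (w + X n)) \<longlonglongrightarrow> 1 + exp (w + 0)"
      by (intro tendsto_intros X)
    ultimately have "exp (D w) = 1 + exp w"
      by (metis LIMSEQ_unique add.right_neutral)
    then show ?thesis by (simp add: D_def)
  qed
qed

text \<open>With \<open>v = w - 2 J i Arg q\<close>, the values at \<open>w + 2 i Arg q\<close> and
  at \<open>w\<close> have the ratio \<open>(1 + exp v) / (1 + exp w)\<close>, by the exponentiated
  difference equation at \<open>v\<close> and at \<open>w\<close>.\<close>

lemma Q_given_by_log_is_Lq:
  assumes g: "generic_unit q" and L: "is_Lq q L"
  shows "Q_given_by_log q J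
    (\<lambda>w. exp (L (w + of_real (- 2 * J - 1) * \<i> * of_real (Arg q)) - L (w - \<i> * of_real (Arg q))))"
proof (rule Q_given_by_logI)
  let ?c = "\<i> * of_real (Arg q)"
  show "norm q = 1" using g by (simp add: generic_unit_def)
  have q0: "q \<noteq> 0" using g by (auto simp: generic_unit_def)
  fix w assume w: "exp w \<in> eta_dom q J"
  define v where "v = w + of_real (- 2 * J) * ?c"
  have v: "exp v = q powr of_real (- 2 * J) * exp w"
    unfolding v_def generic_unit_powr[OF g] exp_add by (simp add: mult_ac)
  \<comment> \<open>The two conditions in \<open>eta_dom\<close> are what the difference equation
    requires at \<open>w\<close> and at \<open>v\<close>.\<close>
  have dom: "1 + q powi (2 * n) * exp w \<noteq> 0" "1 + q powi (2 * n) * exp v \<noteq> 0" for n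
    using w unfolding eta_dom_def v by (auto simp: mult_ac)
  have ne: "exp x \<noteq> - (q powi (2 * n))" if "\<And>n. 1 + q powi (2 * n) * exp x \<noteq> 0" for x n
  proof
    assume "exp x = - (q powi (2 * n))"
    then have "1 + q powi (2 * (- n)) * exp x = 1 - q powi (2 * (- n)) * q powi (2 * n)"
      by simp
    also have "\<dots> = 0" unfolding power_int_add[OF disjI1[OF q0], symmetric] by simp
    finally show False using that by blast
  qed
  have "exp (L (w + ?c) - L (w - ?c)) = 1 + exp w" "exp (L (v + ?c) - L (v - ?c)) = 1 + exp v"
    by (rule exp_is_Lq_difference[OF g L ne], rule dom)+
  then have E: "exp (L (v + ?c)) / exp (L (v - ?c)) = 1 + exp v"
    "exp (L (w + ?c)) / exp (L (w - ?c)) = 1 + exp w"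
    by (simp_all add: exp_diff)
  have args: "w + of_real (- 2 * J - 1) * \<i> * of_real (Arg q) = v - ?c"
    "w + 2 * \<i> * of_real (Arg q) + of_real (- 2 * J - 1) * \<i> * of_real (Arg q) = v + ?c"
    "w + 2 * \<i> * of_real (Arg q) - ?c = w + ?c"
    by (simp_all add: v_def algebra_simps)
  show "exp (L (w + 2 * \<i> * of_real (Arg q) + of_real (- 2 * J - 1) * \<i> * of_real (Arg q))
        - L (w + 2 * \<i> * of_real (Arg q) - ?c)) * (1 + exp w)
      = exp (L (w + of_real (- 2 * J - 1) * \<i> * of_real (Arg q)) - L (w - ?c))
        * (1 + q powr of_real (- 2 * J) * exp w)"
    unfolding args v[symmetric] E[symmetric] by (simp add: exp_diff field_simps)
qed simp

section \<open>Assembly of the cases of J and q\<close>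

theorem proposition3p2:
  fixes q :: complex and J :: real
  assumes J: "0 \<le> J" "2 * J \<in> \<nat>"
    and q: "pos_real q \<or> generic_unit q"
  shows
    "(\<forall>n::nat. J = real n \<longrightarrow>
       Q_given_by q J (\<lambda>\<eta>. \<Prod>k<n. 1 / (1 + \<eta> * q powr of_real (- 2 * J + 2 * real k)))) \<and>
     (J \<notin> \<nat> \<and> pos_real q \<and> Re q < 1 \<longrightarrow>
       (let F = (\<lambda>\<eta> k. (1 + q powr of_real (2 * real k) * \<eta>)
                          / (1 + q powr of_real (- 2 * J + 2 * real k) * \<eta>))
        in (\<forall>\<eta>\<in>eta_dom q J. convergent_prod (F \<eta>)) \<and> Q_given_by q J (\<lambda>\<eta>. \<Prod>k. F \<eta> k))) \<and>
     (J \<notin> \<nat> \<and> pos_real q \<and> 1 < Re q \<longrightarrow>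
       (let F = (\<lambda>\<eta> k. (1 + q powr of_real (- 2 * J - 2 * real k - 2) * \<eta>)
                          / (1 + q powr of_real (- 2 * real k - 2) * \<eta>))
        in (\<forall>\<eta>\<in>eta_dom q J. convergent_prod (F \<eta>)) \<and> Q_given_by q J (\<lambda>\<eta>. \<Prod>k. F \<eta> k))) \<and>
     (J \<notin> \<nat> \<and> generic_unit q \<longrightarrow>
       (\<forall>\<eta>>0. Lq_integrand (Arg q) \<eta> absolutely_integrable_on {0<..}) \<and>
       (\<exists>L. is_Lq q L) \<and>
       (\<forall>L. is_Lq q L \<longrightarrow>
          (\<forall>w. \<bar>Im w\<bar> < pi \<longrightarrow>
             L (w + \<i> * of_real (Arg q)) - L (w - \<i> * of_real (Arg q)) = Ln (1 + exp w)) \<and>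
          Q_given_by_log q J
            (\<lambda>w. exp (L (w + of_real (- 2 * J - 1) * \<i> * of_real (Arg q))
                       - L (w - \<i> * of_real (Arg q))))))"
proof -
  have q0: "q \<noteq> 0" using q by (auto simp: pos_real_def generic_unit_def)
  have norm: "norm q = Re q" if "pos_real q"
    using that by (elim pos_real_cases) simp
  have ex: "\<exists>L. is_Lq q L" if "generic_unit q"
    using is_Lq_Lq_cont[OF that] by blast
  show ?thesis
    unfolding Let_def
    using Q_given_by_integer[OF q0] Q_given_by_prodinf_small[OF q0, of J]
      Q_given_by_prodinf_large[of q J] norm
      absolutely_integrable_Lq_integrand[OF generic_unit_Arg(1,2)] ex
      is_Lq_difference Q_given_by_log_is_Lq
    by auto
qed

end
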